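(* Let $m\in\mathbb{Z}$ be a cube-free integer with $m^2\not\equiv 1\pmod 9$. Write $m=hk^2$ for square-free integers $h,k\in\mathbb{Z}$ with $(h,k)=1$. Let $K=\mathbb{Q}(\sqrt[3]{m})$, let $p\neq 2,3$ be a prime number, and let $r_p$ be the number of roots of $X^3-m=0$ in $\mathbb{Z}/p\mathbb{Z}$ counted without multiplicity. Then for every integer $n\ge 0$, $$\left|\mathcal{M}_{p^n,K}\right|= \begin{cases} \dfrac{p^{\left[\frac{n}{3}\right]+1}-1}{p-1} & \text{if } p\mid m,\\[2ex] \dfrac{p^{\left[\frac{2n}{3}\right]-\left\lceil\frac{n}{3}\right\rceil+1}-1}{p-1}+\dfrac{p^{\left\lceil\frac{n}{3}\right\rceil}-1}{p-1}\,r_p & \text{if } p\nmid m. \end{cases}$$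
   Context: $[x]$ is the floor and $\lceil x\rceil$ the ceiling of $x$. An order of a number field $K$ of degree $d$ is a (unital) subring of $K$ that is a finitely generated $\mathbb{Z}$-module of rank $d$; its index is its index in the ring of integers $\mathcal{O}_K$. Let $\mathcal{M}_N^d$ be the set of $d\times d$ lower triangular integer matrices $(a_{ij})$ with determinant $N$, $a_{ij}\ge 0$ for all $i,j$, and $a_{ij}<a_{jj}$ for $i>j$ (Hermite normal form). Fix an ordered integral basis $\{1,\alpha_1,\ldots,\alpha_{d-1}\}$ of $K$. For $M\in\mathcal{M}_N^d$ let $\mathcal{O}_M=\bigoplus_{i=1}^d\mathbb{Z}v_i\subset\mathcal{O}_K$, where $(v_1,\ldots,v_d)^T=M(1,\alpha_1,\ldots,\alpha_{d-1})^T$. Then $\mathcal{M}_{N,K}=\{M\in\mathcal{M}_N^d : \mathcal{O}_M\text{ is an order}\}$; the map $M\mapsto\mathcal{O}_M$ is a bijection from $\mathcal{M}_{N,K}$ to the set of orders of $K$ of index $N$, so $|\mathcal{M}_{p^n,K}|$ is the number of orders of $K$ of index $p^n$. For the field $K=\mathbb{Q}(\theta)$, $\theta=\sqrt[3]{m}$, of the claim, $d=3$ and the integral basis used is $\{1,\theta,\theta^2/k\}$. *)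

theory Defs
  imports
    Complex_Main
    "HOL-Number_Theory.Cong"
    "HOL-Computational_Algebra.Primes"
    "HOL-Computational_Algebra.Squarefree"
    "Jordan_Normal_Form.Determinant"
begin

text \<open>Number fields are realised as subfields of the complex numbers.\<close>

definition is_subfield :: "complex set \<Rightarrow> bool" where
  "is_subfield F \<longleftrightarrow> 0 \<in> F \<and> 1 \<in> F \<and>
     (\<forall>x\<in>F. \<forall>y\<in>F. x - y \<in> F \<and> x * y \<in> F) \<and> (\<forall>x\<in>F. inverse x \<in> F)"

definition rat_adjoin :: "complex \<Rightarrow> complex set" where
  "rat_adjoin \<theta> = \<Inter> {F. is_subfield F \<and> \<theta> \<in> F}"

global_interpretation int_module: Modules.module "\<lambda>(n::int) (x::complex). of_int n * x"
  defines int_span = int_module.span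
  by standard (auto simp: algebra_simps)

global_interpretation rat_space: Vector_Spaces.vector_space "\<lambda>(q::rat) (x::complex). of_rat q * x"
  defines rat_dim = rat_space.dim
  by standard (auto simp: algebra_simps of_rat_add of_rat_mult)

definition is_subring :: "complex set \<Rightarrow> bool" where
  "is_subring R \<longleftrightarrow> 1 \<in> R \<and> (\<forall>x\<in>R. \<forall>y\<in>R. x - y \<in> R \<and> x * y \<in> R)"

text \<open>
  The rank of a subgroup \<open>R\<close> of \<open>\<complex>\<close> is the dimension of \<open>R \<otimes> \<rat>\<close>, which is the rational
  subspace spanned by \<open>R\<close>; \<open>rat_dim R\<close> is the dimension of that span. Likewise
  \<open>rat_dim K\<close> is the degree of \<open>K\<close>.
\<close>

definition is_order :: "complex set \<Rightarrow> complex set \<Rightarrow> bool" where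
  "is_order K R \<longleftrightarrow> R \<subseteq> K \<and> is_subring R \<and>
     (\<exists>S. finite S \<and> R = int_span S) \<and> rat_dim R = rat_dim K"

text \<open>Hermite normal forms. Rows and columns are indexed from 0.\<close>

definition hnf_mats :: "nat \<Rightarrow> nat \<Rightarrow> int mat set" where
  "hnf_mats d N = {A \<in> carrier_mat d d.
     (\<forall>i<d. \<forall>j<d. i < j \<longrightarrow> A $$ (i, j) = 0) \<and>
     det A = int N \<and>
     (\<forall>i<d. \<forall>j<d. 0 \<le> A $$ (i, j)) \<and>
     (\<forall>i<d. \<forall>j<d. j < i \<longrightarrow> A $$ (i, j) < A $$ (j, j))}"

text \<open>
  The module \<open>\<int>v\<^sub>1 + \<dots> + \<int>v\<^sub>d\<close> with \<open>v = A bs\<close>. The sum is direct whenever \<open>det A \<noteq> 0\<close>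
  and \<open>bs\<close> is linearly independent over the rationals.
\<close>

definition lattice_of_mat :: "complex list \<Rightarrow> int mat \<Rightarrow> complex set" where
  "lattice_of_mat bs A =
     (let v = map_mat of_int A *\<^sub>v vec_of_list bs in int_span {v $ i | i. i < dim_vec v})"

text \<open>
  The list \<open>bs\<close> is meant to be an ordered integral basis of \<open>K\<close> with first entry 1; its length
  is the degree of \<open>K\<close>.
\<close>

definition order_mats :: "complex set \<Rightarrow> complex list \<Rightarrow> nat \<Rightarrow> int mat set" where
  "order_mats K bs N = {A \<in> hnf_mats (length bs) N. is_order K (lattice_of_mat bs A)}"

definition cube_free :: "int \<Rightarrow> bool" where
  "cube_free m \<longleftrightarrow> (\<forall>x. x ^ 3 dvd m \<longrightarrow> x dvd 1)"

definition num_cube_roots_mod :: "nat \<Rightarrow> int \<Rightarrow> nat" where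
  "num_cube_roots_mod p m = card {x \<in> {0..<int p}. [x ^ 3 - m = 0] (mod int p)}"

end

theory Submission imports Defs begin

text \<open>
  Write \<open>\<phi> = \<theta>\<^sup>2/k\<close>, so that \<open>\<theta>\<^sup>2 = k\<phi>\<close>, \<open>\<theta>\<phi> = hk\<close> and \<open>\<phi>\<^sup>2 = h\<theta>\<close>. Since \<open>1\<close> lies in an order, the
  Hermite normal form of an order is that of \<open>\<int> + \<int>a\<theta> + \<int>(b\<theta> + c\<phi>)\<close> with \<open>0 \<le> b < a\<close>, and this lattice is
  a ring iff \<open>c\<close> divides \<open>a\<^sup>2k\<close>, \<open>abk\<close>, \<open>b\<^sup>2k\<close> and \<open>ac\<close> divides \<open>c\<^sup>3h - b\<^sup>3k\<close>. Put \<open>a = p\<^sup>i\<close>, \<open>c = p\<^sup>j\<close>,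
  \<open>i + j = n\<close>. If \<open>p\<^sup>n\<close> divides \<open>c\<^sup>3h\<close>, the conditions reduce to \<open>p\<^sup>t | b\<close> with \<open>t\<close> about \<open>n/3\<close>. Otherwise
  they fail when \<open>p | m\<close>, while for \<open>p\<close> not dividing \<open>m\<close> they force \<open>b = p\<^sup>jb'\<close> with \<open>h - b'\<^sup>3k\<close> divisible by
  \<open>p\<close> to the power \<open>i - 2j\<close>, and Hensel lifting counts the solutions \<open>b'\<close>. Summing over \<open>i\<close> gives geometric
  series.
\<close>

text \<open>These rules from the interpretations in \<open>Defs\<close> loop with associativity and \<open>of_int_mult\<close>.\<close>

declare int_module.scale_scale [simp del] rat_space.scale_scale [simp del]

section \<open>Cubes modulo prime powers\<close>

lemma card_multiples:
  assumes "(m :: int) > 0" "q \<ge> 0"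
  shows "card {b \<in> {0..<m * q}. m dvd b \<and> P (b div m)} = card {b \<in> {0..<q}. P b}"
proof -
  have "{b \<in> {0..<m * q}. m dvd b \<and> P (b div m)} = (\<lambda>b. m * b) ` {b \<in> {0..<q}. P b}"
    using assms by (auto simp: dvd_def zero_le_mult_iff)
  then show ?thesis
    using assms by (simp add: card_image inj_on_def)
qed

text \<open>Division with remainder by \<open>M\<close> cuts the interval into \<open>q\<close>
  translates of one period.\<close>

lemma card_periodic:
  assumes M: "(M :: int) > 0" and P: "\<And>x. P (x mod M) \<longleftrightarrow> P x"
  shows "card {x \<in> {0..<M * int q}. P x} = q * card {x \<in> {0..<M}. P x}"
proof -
  let ?f = "\<lambda>(j, x). x + M * int j"
  have inj: "inj_on ?f ({..<q} \<times> {x \<in> {0..<M}. P x})"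
  proof (rule inj_onI, clarsimp)
    fix i j x y
    assume *: "0 \<le> x" "x < M" "0 \<le> y" "y < M" "x + M * int i = y + M * int j"
    then have "x mod M = y mod M" by (metis mod_mult_self2)
    with * have "x = y" by simp
    with * M show "i = j \<and> x = y" by simp
  qed
  have "{x \<in> {0..<M * int q}. P x} = ?f ` ({..<q} \<times> {x \<in> {0..<M}. P x})" (is "?A = ?B")
  proof
    show "?A \<subseteq> ?B"
    proof
      fix x assume x: "x \<in> ?A"
      let ?j = "nat (x div M)"
      have "M * (x div M) \<le> x" using M by (simp add: minus_mod_eq_mult_div [symmetric])
      also have "x < M * int q" using x by simp
      finally have "x div M < int q" using M by (simp add: mult_less_cancel_left_pos)
      then have "?j < q" using x M by (simp add: pos_imp_zdiv_nonneg_iff nat_less_iff)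
      moreover have "x = ?f (?j, x mod M)"
        using x M by (simp add: pos_imp_zdiv_nonneg_iff)
      moreover have "x mod M \<in> {x \<in> {0..<M}. P x}" using x M P by simp
      ultimately show "x \<in> ?B" by blast
    qed
    show "?B \<subseteq> ?A"
    proof
      fix y assume "y \<in> ?B"
      then obtain j x where *: "j < q" "0 \<le> x" "x < M" "P x" and y: "y = x + M * int j"
        by auto
      have "y < M * (int j + 1)" using * by (simp add: y algebra_simps)
      also have "\<dots> \<le> M * int q" using * M by (intro mult_left_mono) auto
      finally have "y < M * int q" .
      moreover have "P y" using P[of y] P[of x] * by (simp add: y)
      ultimately show "y \<in> ?A" using * M by (simp add: y)
    qed
  qed
  then show ?thesis
    using card_image[OF inj] by (simp add: card_cartesian_product)
qed

text \<open>The two inequalities say that \<open>t\<close> is n/3 rounded up. The multiplicity of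
  \<open>p\<close> in a cube is three times that in the base, so it reaches \<open>n\<close> exactly
  when the latter reaches \<open>t\<close>.\<close>

lemma prime_power_dvd_cube_iff:
  fixes p :: int
  assumes "prime p" "n \<le> 3 * t" "3 * t < n + 3"
  shows "p ^ n dvd b ^ 3 \<longleftrightarrow> p ^ t dvd b"
proof (cases "b = 0")
  case False
  have u: "\<not> is_unit p" "prime_elem p"
    using assms(1) by (auto simp: not_prime_unit)
  have "p ^ n dvd b ^ 3 \<longleftrightarrow> n \<le> multiplicity p (b ^ 3)"
    using False u(1) by (intro power_dvd_iff_le_multiplicity) simp_all
  also have "\<dots> \<longleftrightarrow> n \<le> 3 * multiplicity p b"
    using False u(2) by (simp add: prime_elem_multiplicity_power_distrib)
  also have "\<dots> \<longleftrightarrow> t \<le> multiplicity p b"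
    using assms by linarith
  also have "\<dots> \<longleftrightarrow> p ^ t dvd b"
    using False u(1) by (intro power_dvd_iff_le_multiplicity[symmetric])
  finally show ?thesis .
qed simp

lemma prime_power_dvd_mult_iff:
  fixes p :: int
  assumes "prime p" "\<not> p dvd k"
  shows "p ^ n dvd b * k \<longleftrightarrow> p ^ n dvd b"
proof -
  have "coprime (p ^ n) k" using assms by (simp add: prime_imp_coprime)
  then show ?thesis by (rule coprime_dvd_mult_left_iff)
qed

text \<open>Reduction modulo \<open>p ^ e\<close> is a bijection between the two root sets. Every
  root is a unit because \<open>p\<close> does not divide \<open>h\<close>, so the derivative
  \<open>3 * x\<^sup>2 * k\<close> is a unit too (here \<open>p \<noteq> 3\<close> enters), and each
  root lifts uniquely.\<close>

lemma hensel_step: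
  fixes h k :: int
  assumes p: "prime p" "p \<noteq> 3" and hk: "\<not> int p dvd h" "\<not> int p dvd k" and e: "e > 0"
  shows "card {x \<in> {0..<int p ^ Suc e}. int p ^ Suc e dvd h - x ^ 3 * k} =
         card {x \<in> {0..<int p ^ e}. int p ^ e dvd h - x ^ 3 * k}"
proof (rule bij_betw_same_card)
  let ?P = "int p"
  let ?A = "{x \<in> {0..<?P ^ Suc e}. ?P ^ Suc e dvd h - x ^ 3 * k}"
  let ?B = "{x \<in> {0..<?P ^ e}. ?P ^ e dvd h - x ^ 3 * k}"
  have pi: "prime ?P" using p by simp
  have pos: "?P > 0" using p by (simp add: prime_gt_0_nat[of p])
  have n3: "\<not> ?P dvd 3"
    using p primes_dvd_imp_eq[of ?P 3] by auto
  have Pe: "?P dvd ?P ^ e" using e by (simp add: dvd_power)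
  have ndvd: "\<not> ?P dvd x" if "?P ^ e dvd h - x ^ 3 * k" for x
  proof
    assume "?P dvd x"
    then have "?P dvd x ^ 3 * k" by (simp add: power3_eq_cube)
    moreover have "?P dvd h - x ^ 3 * k" using dvd_trans[OF Pe that] .
    ultimately show False using hk(1) zdvd_zdiffD by blast
  qed
  have cube_diff: "x ^ 3 * k - y ^ 3 * k = (x - y) * ((x\<^sup>2 + x * y + y\<^sup>2) * k)" for x y :: int
    by (simp add: power2_eq_square power3_eq_cube algebra_simps)
  show "bij_betw (\<lambda>x. x mod ?P ^ e) ?A ?B"
    unfolding bij_betw_def
  proof
    show "inj_on (\<lambda>x. x mod ?P ^ e) ?A"
    proof (rule inj_onI)
      fix x y assume x: "x \<in> ?A" and y: "y \<in> ?A" and xy: "x mod ?P ^ e = y mod ?P ^ e"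
      have "?P ^ e dvd x - y" using xy by (simp add: mod_eq_dvd_iff)
      then have pxy: "?P dvd x - y" using dvd_trans[OF Pe] by blast
      have "?P ^ Suc e dvd h - x ^ 3 * k" using x by blast
      then have "?P ^ e dvd h - x ^ 3 * k" by (rule dvd_trans[OF le_imp_power_dvd, rotated]) simp
      then have nx: "\<not> ?P dvd x" by (rule ndvd)
      have "\<not> ?P dvd (x\<^sup>2 + x * y + y\<^sup>2) * k"
      proof
        assume "?P dvd (x\<^sup>2 + x * y + y\<^sup>2) * k"
        then have "?P dvd x\<^sup>2 + x * y + y\<^sup>2" using pi hk prime_dvd_mult_iff by blast
        \<comment> \<open>Modulo \<open>x - y\<close> the quadratic cofactor is
          \<open>3 * x\<^sup>2\<close>, which is prime to \<open>p\<close>. Hence the whole power of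
          \<open>p\<close> falls on \<open>x - y\<close>.\<close>
        then have "?P dvd (x\<^sup>2 + x * y + y\<^sup>2) + (x - y) * (2 * x + y)"
          using pxy by (rule dvd_add[OF _ dvd_mult2])
        also have "\<dots> = 3 * x\<^sup>2"
          by (simp add: power2_eq_square algebra_simps)
        finally have "?P dvd 3 * x\<^sup>2" .
        then show False using pi n3 nx by (simp add: prime_dvd_mult_iff prime_dvd_power_iff)
      qed
      moreover have "?P ^ Suc e dvd (h - y ^ 3 * k) - (h - x ^ 3 * k)"
        using x y by (intro dvd_diff[of _ "h - y ^ 3 * k"]) blast+
      then have "?P ^ Suc e dvd (x - y) * ((x\<^sup>2 + x * y + y\<^sup>2) * k)"
        unfolding cube_diff[symmetric] by simp
      ultimately have "?P ^ Suc e dvd x - y"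
        using prime_power_dvd_mult_iff[OF pi] by blast
      then have "x mod ?P ^ Suc e = y mod ?P ^ Suc e" by (simp only: mod_eq_dvd_iff)
      then show "x = y" using x y by simp
    qed
    show "(\<lambda>x. x mod ?P ^ e) ` ?A = ?B"
    proof
      show "(\<lambda>x. x mod ?P ^ e) ` ?A \<subseteq> ?B"
      proof clarify
        fix x assume x: "x \<in> {0..<?P ^ Suc e}" "?P ^ Suc e dvd h - x ^ 3 * k"
        have "[h - (x mod ?P ^ e) ^ 3 * k = h - x ^ 3 * k] (mod ?P ^ e)"
          by (intro cong_diff cong_mult cong_pow cong_refl) (simp add: cong_def)
        moreover have "?P ^ e dvd h - x ^ 3 * k" using x(2) by (auto dest: dvd_mult_right)
        ultimately show "x mod ?P ^ e \<in> {0..<?P ^ e} \<and> ?P ^ e dvd h - (x mod ?P ^ e) ^ 3 * k"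
          using pos by (simp add: cong_dvd_iff)
      qed
      show "?B \<subseteq> (\<lambda>x. x mod ?P ^ e) ` ?A"
      proof
        fix y assume y: "y \<in> ?B"
        then obtain c where c: "h - y ^ 3 * k = ?P ^ e * c" by (auto elim: dvdE)
        have "\<not> ?P dvd y" using y ndvd by blast
        then have "coprime ?P (3 * y\<^sup>2 * k)"
          using pi n3 hk(2) by (intro prime_imp_coprime)
            (auto simp: prime_dvd_mult_iff prime_dvd_power_iff)
        then obtain i where i: "[3 * y\<^sup>2 * k * i = 1] (mod ?P)"
          using cong_solve_coprime_int coprime_commute by blast
        \<comment> \<open>The Newton correction: \<open>z\<close> solves
          \<open>3 * y\<^sup>2 * k * z = c\<close> modulo \<open>p\<close>, which cancels the error
          \<open>p ^ e * c\<close> to one order more.\<close>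
        define z where "z = (i * c) mod ?P"
        define x where "x = y + ?P ^ e * z"
        have z: "0 \<le> z" "z < ?P" using pos by (simp_all add: z_def)
        have "[3 * y\<^sup>2 * k * z = 3 * y\<^sup>2 * k * (i * c)] (mod ?P)"
          unfolding z_def by (intro cong_mult cong_refl) (simp add: cong_def)
        also have "3 * y\<^sup>2 * k * (i * c) = (3 * y\<^sup>2 * k * i) * c" by simp
        also have "[\<dots> = 1 * c] (mod ?P)" using i by (intro cong_mult cong_refl)
        finally have "?P dvd c - 3 * y\<^sup>2 * k * z"
          by (simp add: cong_iff_dvd_diff dvd_diff_commute)
        then have "?P * ?P ^ e dvd ?P ^ e * (c - 3 * y\<^sup>2 * k * z)"
          by (subst mult.commute) (intro mult_dvd_mono dvd_refl)
        \<comment> \<open>The quadratic and cubic terms of the expansion carry \<open>p ^ e\<close>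
          twice, and one of the two copies supplies the extra \<open>p\<close> because
          \<open>e > 0\<close>.\<close>
        moreover have "?P * ?P ^ e dvd ?P ^ e * ?P ^ e * (3 * y * z\<^sup>2 * k + ?P ^ e * z ^ 3 * k)"
          by (intro dvd_mult2 mult_dvd_mono Pe dvd_refl)
        ultimately have "?P * ?P ^ e dvd ?P ^ e * (c - 3 * y\<^sup>2 * k * z)
           - ?P ^ e * ?P ^ e * (3 * y * z\<^sup>2 * k + ?P ^ e * z ^ 3 * k)"
          by (rule dvd_diff)
        also have "\<dots> = h - x ^ 3 * k"
          unfolding x_def using c by (simp add: power2_eq_square power3_eq_cube algebra_simps)
        finally have "?P ^ Suc e dvd h - x ^ 3 * k" by simp
        moreover have "0 \<le> x" using y z pos by (simp add: x_def)
        moreover have "x < ?P ^ Suc e"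
        proof -
          have "x < ?P ^ e * (z + 1)" using y by (simp add: x_def algebra_simps)
          also have "\<dots> \<le> ?P ^ e * ?P" using z pos by (intro mult_left_mono) auto
          finally show ?thesis by (simp add: mult.commute)
        qed
        moreover have "x mod ?P ^ e = y" using y by (simp add: x_def)
        ultimately show "y \<in> (\<lambda>x. x mod ?P ^ e) ` ?A" by force
      qed
    qed
  qed
qed

text \<open>Hensel lifting descends to \<open>e = 1\<close>. There \<open>x \<mapsto> k * x\<close>
  turns the solutions of h = x^3 k into the cube roots of h k^2, since (k x)^3 - h k^2 = - k^2 (h -
  x^3 k) and \<open>k\<close> is a unit.\<close>

lemma card_cube_roots_prime_power:
  fixes h k :: int
  assumes p: "prime p" "p \<noteq> 3" and hk: "\<not> int p dvd h" "\<not> int p dvd k" and e: "e > 0"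
  shows "card {x \<in> {0..<int p ^ e}. int p ^ e dvd h - x ^ 3 * k} = num_cube_roots_mod p (h * k\<^sup>2)"
  using e
proof (induction e rule: nat_induct_non_zero)
  case (Suc e)
  then show ?case using hensel_step[OF p hk, of e] by simp
next
  case 1
  let ?P = "int p"
  have pi: "prime ?P" and pos: "?P > 0" using p by (simp_all add: prime_gt_0_nat[of p])
  obtain i where i: "[k * i = 1] (mod ?P)"
    using hk(2) pi cong_solve_coprime_int prime_imp_coprime coprime_commute by blast
  have eq: "?P dvd (k * x mod ?P) ^ 3 - h * k\<^sup>2 \<longleftrightarrow> ?P dvd h - x ^ 3 * k" for x
  proof -
    have "[(k * x mod ?P) ^ 3 - h * k\<^sup>2 = (k * x) ^ 3 - h * k\<^sup>2] (mod ?P)"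
      by (intro cong_diff cong_pow cong_refl) (simp add: cong_def)
    also have "(k * x) ^ 3 - h * k\<^sup>2 = - (k\<^sup>2 * (h - x ^ 3 * k))"
      by (simp add: power2_eq_square power3_eq_cube algebra_simps)
    finally show ?thesis
      using pi hk(2) by (simp add: cong_dvd_iff prime_dvd_mult_iff prime_dvd_power_iff)
  qed
  have "bij_betw (\<lambda>x. k * x mod ?P) {x \<in> {0..<?P}. ?P dvd h - x ^ 3 * k}
      {x \<in> {0..<?P}. ?P dvd x ^ 3 - h * k\<^sup>2}"
    unfolding bij_betw_def
  proof
    show "inj_on (\<lambda>x. k * x mod ?P) {x \<in> {0..<?P}. ?P dvd h - x ^ 3 * k}"
    proof (rule inj_onI)
      fix x y assume x: "x \<in> {x \<in> {0..<?P}. ?P dvd h - x ^ 3 * k}"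
        and y: "y \<in> {x \<in> {0..<?P}. ?P dvd h - x ^ 3 * k}" and "k * x mod ?P = k * y mod ?P"
      then have "?P dvd k * (x - y)" by (simp add: mod_eq_dvd_iff right_diff_distrib)
      then have "?P dvd x - y" using pi hk(2) prime_dvd_mult_iff by blast
      then have "x mod ?P = y mod ?P" by (simp only: mod_eq_dvd_iff)
      then show "x = y" using x y by simp
    qed
    show "(\<lambda>x. k * x mod ?P) ` {x \<in> {0..<?P}. ?P dvd h - x ^ 3 * k} =
      {x \<in> {0..<?P}. ?P dvd x ^ 3 - h * k\<^sup>2}" (is "?L = ?R")
    proof
      show "?L \<subseteq> ?R" using eq pos by auto
      show "?R \<subseteq> ?L"
      proof
        fix y assume y: "y \<in> ?R"
        let ?x = "i * y mod ?P"
        have "[k * ?x = k * (i * y)] (mod ?P)" by (intro cong_mult cong_refl) (simp add: cong_def)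
        also have "k * (i * y) = (k * i) * y" by simp
        also have "[\<dots> = 1 * y] (mod ?P)" using i by (intro cong_mult cong_refl)
        finally have y': "k * ?x mod ?P = y" using y by (simp add: cong_def)
        then have "?P dvd h - ?x ^ 3 * k" using eq[of ?x] y by simp
        then show "y \<in> ?L" using y' pos by (intro image_eqI[of _ _ ?x]) auto
      qed
    qed
  qed
  then show ?case
    by (simp add: bij_betw_same_card num_cube_roots_mod_def cong_0_iff)
qed

section \<open>Divisibility by prime powers, multiples in an interval, geometric sums\<close>

lemma prime_power_dvd_prime_power_iff:
  "prime p \<Longrightarrow> (p :: int) ^ a dvd p ^ b \<longleftrightarrow> a \<le> b"
  by (metis dvd_power_iff not_prime_0 not_prime_unit)

lemma prime_power_dvd_power_mult_iff:
  assumes "prime (p :: int)" "a \<le> b"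
  shows "p ^ b dvd p ^ a * x \<longleftrightarrow> p ^ (b - a) dvd x"
proof -
  have "p ^ b = p ^ a * p ^ (b - a)" using assms(2) by (simp flip: power_add)
  then show ?thesis using assms(1) by simp
qed

text \<open>The coefficient supplies one factor \<open>p\<close>, so \<open>t\<close> is (n - 1)/3
  rounded up, which is 0 for \<open>n = 0\<close>. This serves the case where \<open>p\<close>
  divides \<open>k\<close>.\<close>

lemma prime_power_dvd_prime_mult_cube_iff:
  fixes p :: int
  assumes p: "prime p" and t: "n \<le> 3 * t + 1" "3 * t < n + 2"
  shows "p ^ n dvd p * b ^ 3 \<longleftrightarrow> p ^ t dvd b"
proof (cases n)
  case 0
  then have "t = 0" using t by linarith
  then show ?thesis using 0 by simp
next
  case (Suc n')
  then have "p ^ n dvd p * b ^ 3 \<longleftrightarrow> p ^ n' dvd b ^ 3" using p by simp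
  also have "\<dots> \<longleftrightarrow> p ^ t dvd b" using Suc t by (intro prime_power_dvd_cube_iff[OF p]) auto
  finally show ?thesis .
qed

lemma card_prime_power_multiples:
  assumes "prime p" "t \<le> i"
  shows "card {b \<in> {0..<int p ^ i}. int p ^ t dvd b} = p ^ (i - t)"
proof -
  have "int p ^ i = int p ^ t * int p ^ (i - t)" using assms(2) by (simp flip: power_add)
  then have "card {b \<in> {0..<int p ^ i}. int p ^ t dvd b} = card {b \<in> {0..<int p ^ (i - t)}. True}"
    using card_multiples[of "int p ^ t" "int p ^ (i - t)" "\<lambda>_. True"] prime_gt_0_nat[OF assms(1)]
    by simp
  also have "{b \<in> {0..<int p ^ (i - t)}. True} = {0..<int p ^ (i - t)}" by blast
  also have "card \<dots> = nat (int p ^ (i - t))" by simp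
  finally show ?thesis by (simp add: nat_power_eq)
qed

text \<open>The bound \<open>t \<le> Suc u\<close> admits an empty range; this happens for
  \<open>n = 1\<close> when \<open>p\<close> does not divide \<open>m\<close>.\<close>

lemma sum_powers_shift:
  fixes q :: nat
  assumes "t \<le> Suc u" "u \<le> n"
  shows "(\<Sum>i\<le>n. if t \<le> i \<and> i \<le> u then q ^ (i - t) else 0) = (\<Sum>s<Suc u - t. q ^ s)"
proof -
  have "(\<Sum>i\<le>n. if t \<le> i \<and> i \<le> u then q ^ (i - t) else 0) = (\<Sum>i\<in>{t..<Suc u}. q ^ (i - t))"
    using assms by (intro sum.mono_neutral_cong_right) auto
  also have "\<dots> = (\<Sum>s<Suc u - t. q ^ s)"
    using assms by (intro sum.reindex_bij_witness[of _ "\<lambda>s. s + t" "\<lambda>i. i - t"]) auto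
  finally show ?thesis .
qed

text \<open>The two left sides count the admissible exponents \<open>i\<close> when \<open>p\<close>
  divides \<open>h\<close> and when it divides \<open>k\<close>. Their agreement is why a single
  formula covers all \<open>p\<close> dividing \<open>m\<close>.\<close>

lemma div_3_differences:
  fixes n :: nat
  shows "Suc ((2 * n + 1) div 3) - (n + 2) div 3 = n div 3 + 1"
    and "Suc (2 * n div 3) - (n + 1) div 3 = n div 3 + 1"
proof -
  define q r where "q = n div 3" and "r = n mod 3"
  have n: "n = 3 * q + r" "r < 3" by (simp_all add: q_def r_def)
  then consider "n = 3 * q" | "n = 3 * q + 1" | "n = 3 * q + 2" by linarith
  then have "(n + 2) div 3 + q = (2 * n + 1) div 3 \<and> (n + 1) div 3 + q = 2 * n div 3"
  proof cases
    case 1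
    have "(n + 2) div 3 = q" "(2 * n + 1) div 3 = 2 * q" "(n + 1) div 3 = q" "2 * n div 3 = 2 * q"
      unfolding 1 by (intro div_nat_eqI; simp)+
    then show ?thesis by simp
  next
    case 2
    have "(n + 2) div 3 = q + 1" "(2 * n + 1) div 3 = 2 * q + 1" "(n + 1) div 3 = q" "2 * n div 3 = 2 * q"
      unfolding 2 by (intro div_nat_eqI; simp)+
    then show ?thesis by simp
  next
    case 3
    have "(n + 2) div 3 = q + 1" "(2 * n + 1) div 3 = 2 * q + 1" "(n + 1) div 3 = q + 1" "2 * n div 3 = 2 * q + 1"
      unfolding 3 by (intro div_nat_eqI; simp)+
    then show ?thesis by simp
  qed
  then show "Suc ((2 * n + 1) div 3) - (n + 2) div 3 = n div 3 + 1"
    and "Suc (2 * n div 3) - (n + 1) div 3 = n div 3 + 1"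
    unfolding q_def by linarith+
qed

lemma sum_powers_real:
  "(p :: nat) > 1 \<Longrightarrow> real (\<Sum>s<a. p ^ s) = (real p ^ a - 1) / (real p - 1)"
  by (simp add: geometric_sum)

text \<open>A rational cube root of \<open>m\<close> is an integer, and cube-freeness makes it 1 or
  -1. Then \<open>m\<^sup>2 = 1\<close>, against the congruence hypothesis.\<close>

lemma cube_free_not_rat_cube:
  assumes cf: "cube_free m" and m1: "\<not> [m\<^sup>2 = 1] (mod 9)"
  shows "(q :: rat) ^ 3 \<noteq> of_int m"
proof
  assume q: "q ^ 3 = of_int m"
  obtain a b where ab: "quotient_of q = (a, b)" by fastforce
  then have b: "b > 0" "coprime a b" and "q = of_int a / of_int b"
    using quotient_of_denom_pos quotient_of_coprime quotient_of_div by blast+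
  then have "of_int m * of_int b ^ 3 = (of_int a :: rat) ^ 3"
    by (simp add: power_divide flip: q)
  then have "(of_int (a ^ 3) :: rat) = of_int (m * b ^ 3)" by simp
  then have eq: "a ^ 3 = m * b ^ 3" by (simp only: of_int_eq_iff)
  have "coprime (b ^ 3) (a ^ 3)" using b(2) by (simp add: coprime_commute)
  moreover have "b ^ 3 dvd a ^ 3" by (simp add: eq)
  ultimately have "is_unit (b ^ 3)" using coprime_absorb_left by blast
  then have "is_unit b" unfolding is_unit_power_iff by simp
  then have "b = 1" using b(1) by simp
  then have am: "a ^ 3 = m" using eq by simp
  then have "a dvd 1" using cf unfolding cube_free_def by auto
  then have "a\<^sup>2 = 1" by (auto simp: zdvd1_eq abs_if split: if_splits)
  moreover have "m\<^sup>2 = (a\<^sup>2) ^ 3" by (simp flip: am power_mult)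
  ultimately have "m\<^sup>2 = 1" by simp
  then show False using m1 by simp
qed

section \<open>Integer matrices of size three\<close>

lemma all_less_3: "(\<forall>i<3. P i) \<longleftrightarrow> P 0 \<and> P (1 :: nat) \<and> P 2"
  by (auto simp: numeral_3_eq_3 numeral_2_eq_2 less_Suc_eq)

lemma det_lower_triangular_3:
  assumes "A \<in> carrier_mat 3 3" "\<forall>i<3. \<forall>j<3. i < j \<longrightarrow> A $$ (i, j) = 0"
  shows "det A = A $$ (0,0) * A $$ (1,1) * (A $$ (2,2) :: int)"
proof -
  have "det A = prod_list (diag_mat A)"
    using assms by (intro det_lower_triangular[of 3]) auto
  then show ?thesis
    using assms(1) by (simp add: diag_mat_def numeral_3_eq_3 numeral_2_eq_2)
qed

text \<open>The shape of a Hermite normal form whose lattice contains 1: its rows give 1, a\<theta>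
  and b\<theta> + c\<theta>^2/k.\<close>

definition hnf_mat :: "int \<Rightarrow> int \<Rightarrow> int \<Rightarrow> int mat" where
  "hnf_mat a b c = mat 3 3 (\<lambda>(i, j). [[1, 0, 0], [0, a, 0], [0, b, c]] ! i ! j)"

lemma hnf_mat_index [simp]:
  "hnf_mat a b c \<in> carrier_mat 3 3"
  "hnf_mat a b c $$ (0,0) = 1" "hnf_mat a b c $$ (0,Suc 0) = 0" "hnf_mat a b c $$ (0,2) = 0"
  "hnf_mat a b c $$ (Suc 0,0) = 0" "hnf_mat a b c $$ (Suc 0,Suc 0) = a" "hnf_mat a b c $$ (Suc 0,2) = 0"
  "hnf_mat a b c $$ (2,0) = 0" "hnf_mat a b c $$ (2,Suc 0) = b" "hnf_mat a b c $$ (2,2) = c"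
  by (simp_all add: hnf_mat_def numeral_2_eq_2)

lemma eq_hnf_mat:
  assumes "A \<in> carrier_mat 3 3" "\<forall>i<3. \<forall>j<3. i < j \<longrightarrow> A $$ (i, j) = 0"
    and "A $$ (0,0) = 1" "A $$ (1,0) = 0" "A $$ (2,0) = 0"
  shows "A = hnf_mat (A $$ (1,1)) (A $$ (2,1)) (A $$ (2,2))"
proof (rule eq_matI)
  fix i j assume "i < dim_row (hnf_mat (A $$ (1,1)) (A $$ (2,1)) (A $$ (2,2)))"
    and "j < dim_col (hnf_mat (A $$ (1,1)) (A $$ (2,1)) (A $$ (2,2)))"
  then have "i = 0 \<or> i = 1 \<or> i = 2" "j = 0 \<or> j = 1 \<or> j = 2"
    by (auto simp: hnf_mat_def)
  then show "A $$ (i, j) = hnf_mat (A $$ (1,1)) (A $$ (2,1)) (A $$ (2,2)) $$ (i, j)"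
    using assms by (auto simp: all_less_3)
qed (use assms(1) in \<open>auto simp: hnf_mat_def\<close>)

section \<open>Lattices in a pure cubic field\<close>

lemma int_span_3:
  "int_span {u, v, w} = {of_int x * u + of_int y * v + of_int z * w | x y z. True}"
  unfolding int_module.span_insert int_module.span_empty
  by (simp only: diff_diff_eq mem_Collect_eq singleton_iff eq_iff_diff_eq_0[symmetric]
      diff_eq_eq simp_thms add_ac add_0_left add_0_right)

lemma subfield_of_int: "is_subfield F \<Longrightarrow> of_int n \<in> F"
proof (induction n rule: int_induct[where k = 0])
  case (step1 i)
  then have "0 - 1 \<in> F" unfolding is_subfield_def by blast
  then have "of_int i - (0 - 1) \<in> F" using step1 unfolding is_subfield_def by blast
  then show ?case by simp
next
  case (step2 i)
  then show ?case unfolding is_subfield_def by auto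
qed (simp add: is_subfield_def)

lemma subfield_of_rat: assumes "is_subfield F" shows "of_rat q \<in> F"
proof -
  obtain a b where "quotient_of q = (a, b)" by fastforce
  then have "of_rat q = (of_int a * inverse (of_int b) :: complex)"
    using quotient_of_div[of q a b] by (simp add: of_rat_divide field_simps)
  then show ?thesis
    using assms subfield_of_int[OF assms] unfolding is_subfield_def by metis
qed

lemma subfield_add:
  assumes "is_subfield F" "x \<in> F" "y \<in> F" shows "x + y \<in> F"
proof -
  have "x - (0 - y) \<in> F" using assms unfolding is_subfield_def by blast
  then show ?thesis by simp
qed

text \<open>The two assumptions make X^3 - h k^2 irreducible over the rationals, which is what the
  field arithmetic below rests on.\<close>

locale pure_cubic =
  fixes h k :: int and \<theta> :: complex
  assumes cube: "\<theta> ^ 3 = of_int (h * k\<^sup>2)"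
    and not_cube: "\<And>q :: rat. q ^ 3 \<noteq> of_int (h * k\<^sup>2)"
begin

section \<open>Arithmetic in coordinates with respect to the basis 1, \<theta>, \<theta>^2/k\<close>

definition cmb :: "rat \<Rightarrow> rat \<Rightarrow> rat \<Rightarrow> complex" where
  "cmb x y z = of_rat x + of_rat y * \<theta> + of_rat z * (\<theta>\<^sup>2 / of_int k)"

text \<open>The lattice of \<open>hnf_mat a b c\<close>, given by coordinates rather than as a span,
  so that membership becomes solvability of integer equations.\<close>

definition lat :: "int \<Rightarrow> int \<Rightarrow> int \<Rightarrow> complex set" where
  "lat a b c = {cmb (of_int x) (of_int (a * y + b * z)) (of_int (c * z)) | x y z. True}"

lemma nonzero: "h \<noteq> 0" "k \<noteq> 0"
  using not_cube[of 0] by auto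

lemma irrational: "\<theta> \<noteq> of_rat q"
proof
  assume "\<theta> = of_rat q"
  then have "(of_rat (q ^ 3) :: complex) = of_rat (of_int (h * k\<^sup>2))"
    using cube by (simp add: of_rat_power of_rat_mult)
  then show False
    using not_cube of_rat_eq_iff by blast
qed

text \<open>If \<open>z\<close> were nonzero, \<open>k * y / z\<close> would be a rational cube root
  of h k^2.\<close>

lemma no_rat_cube_ratio:
  assumes "y ^ 3 * of_int k = of_int h * (z :: rat) ^ 3"
  shows "z = 0"
proof (rule ccontr)
  assume "z \<noteq> 0"
  have "(of_int k * y / z) ^ 3 = of_int k ^ 2 * (y ^ 3 * of_int k) / z ^ 3"
    by (simp add: power_divide power_mult_distrib power3_eq_cube power2_eq_square)
  also have "\<dots> = of_int (h * k\<^sup>2)"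
    using \<open>z \<noteq> 0\<close> by (simp add: assms)
  finally show False
    using not_cube by blast
qed

text \<open>The hypotheses say that the product of the other two conjugates of
  \<open>cmb x y z\<close> has all coordinates zero. They give k y^3 = x y z = h z^3, which
  \<open>no_rat_cube_ratio\<close> excludes unless \<open>z = 0\<close>.\<close>

lemma cofactor_zero:
  assumes "x\<^sup>2 = of_int (h * k) * (y * z)" "of_int h * z\<^sup>2 = x * y" "of_int k * y\<^sup>2 = x * (z :: rat)"
  shows "x = 0 \<and> y = 0 \<and> z = 0"
proof -
  have "y ^ 3 * of_int k = y * (of_int k * y\<^sup>2)"
    by (simp add: power3_eq_cube power2_eq_square)
  also have "\<dots> = x * y * z" by (simp add: assms(3))
  also have "\<dots> = of_int h * z ^ 3"
    by (simp flip: assms(2) add: power3_eq_cube power2_eq_square)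
  finally have "z = 0" by (rule no_rat_cube_ratio)
  with assms nonzero show ?thesis by simp
qed

lemma cmb_mult:
  "cmb x y z * cmb x' y' z' =
     cmb (x * x' + of_int (h * k) * (y * z' + y' * z))
         (x * y' + x' * y + of_int h * (z * z'))
         (x * z' + x' * z + of_int k * (y * y'))"
proof -
  have k: "(of_int k :: complex) \<noteq> 0" using nonzero by simp
  have 3: "\<theta> * \<theta> * \<theta> = of_int h * of_int k * of_int k"
    using cube by (simp add: power3_eq_cube power2_eq_square)
  define f where "f = \<theta>\<^sup>2 / of_int k"
  have f1: "of_int k * f = \<theta> * \<theta>"
    using k by (simp add: f_def power2_eq_square)
  have "of_int k * (\<theta> * f) = \<theta> * (of_int k * f)"
    by (simp only: mult.left_commute)
  also have "\<dots> = of_int k * (of_int h * of_int k)"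
    unfolding f1 using 3 by (simp only: mult_ac)
  finally have f2: "\<theta> * f = of_int h * of_int k"
    using k by simp
  have "of_int k * (f * f) = (of_int k * f) * f"
    by (simp only: mult_ac)
  also have "\<dots> = \<theta> * (\<theta> * f)"
    unfolding f1 by (simp only: mult_ac)
  also have "\<dots> = of_int k * (of_int h * \<theta>)"
    unfolding f2 by (simp only: mult_ac)
  finally have f3: "f * f = of_int h * \<theta>"
    using k by simp
  \<comment> \<open>The expansion is done for arbitrary complex coefficients, which keeps the
    embeddings of the rationals out of the algebra.\<close>
  have "(X + Y * \<theta> + Z * f) * (X' + Y' * \<theta> + Z' * f) =
      X * X' + (X * Y' + X' * Y) * \<theta> + (X * Z' + X' * Z) * f
      + (Y * Y') * (\<theta> * \<theta>) + (Y * Z' + Y' * Z) * (\<theta> * f) + (Z * Z') * (f * f)" (is "_ = ?R X Y Z X' Y' Z'")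
    for X Y Z X' Y' Z'
    by (simp add: algebra_simps)
  moreover have "?R X Y Z X' Y' Z' = (X * X' + of_int h * of_int k * (Y * Z' + Y' * Z))
      + (X * Y' + X' * Y + of_int h * (Z * Z')) * \<theta> + (X * Z' + X' * Z + of_int k * (Y * Y')) * f"
    for X Y Z X' Y' Z'
    unfolding f1[symmetric] f2 f3 by (simp add: algebra_simps)
  ultimately show ?thesis
    unfolding cmb_def f_def[symmetric] of_rat_add of_rat_mult of_int_mult of_rat_of_int_eq by metis
qed

lemma cmb_diff: "cmb x y z - cmb x' y' z' = cmb (x - x') (y - y') (z - z')"
  by (simp add: cmb_def of_rat_diff diff_divide_distrib left_diff_distrib)

lemma cmb_scale: "of_rat q * cmb x y z = cmb (q * x) (q * y) (q * z)"
  by (simp add: cmb_def of_rat_mult distrib_left mult.assoc)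

lemma cmb_eq_0_iff: "cmb x y z = 0 \<longleftrightarrow> x = 0 \<and> y = 0 \<and> z = 0"
proof
  assume 0: "cmb x y z = 0"
  \<comment> \<open>Multiplying the relation by \<open>\<theta>\<close> and eliminating \<open>\<theta>\<^sup>2\<close> leaves a linear relation in \<open>\<theta>\<close>.\<close>
  define u where "u = of_int k * y\<^sup>2 - x * z"
  define w where "w = of_int k * (x * y) - of_int (h * k) * z\<^sup>2"
  have "cmb x y z * cmb 0 1 0 = 0" using 0 by simp
  then have 1: "cmb (of_int (h * k) * z) x (of_int k * y) = 0"
    by (simp add: cmb_mult)
  have "cmb w u 0 = of_rat (of_int k * y) * cmb x y z - of_rat z * cmb (of_int (h * k) * z) x (of_int k * y)"
    unfolding cmb_scale cmb_diff u_def w_def by (simp add: power2_eq_square algebra_simps)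
  then have wu: "of_rat w + of_rat u * \<theta> = 0" using 0 1 by (simp add: cmb_def)
  have "u = 0"
  proof (rule ccontr)
    assume "u \<noteq> 0"
    then have "\<theta> = of_rat (- w / u)"
      using wu by (simp add: of_rat_divide of_rat_minus field_simps eq_neg_iff_add_eq_0)
    then show False using irrational by blast
  qed
  with wu have "w = 0" by simp
  have yz: "of_int h * z\<^sup>2 = x * y" "of_int k * y\<^sup>2 = x * z"
    using \<open>u = 0\<close> \<open>w = 0\<close> nonzero by (auto simp: u_def w_def)
  have "y ^ 3 * of_int k = y * (of_int k * y\<^sup>2)"
    by (simp add: power3_eq_cube power2_eq_square)
  also have "\<dots> = x * y * z" by (simp add: yz)
  also have "\<dots> = of_int h * z ^ 3"
    by (simp flip: yz(1) add: power3_eq_cube power2_eq_square)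
  finally have "z = 0" by (rule no_rat_cube_ratio)
  moreover have "y = 0" using yz \<open>z = 0\<close> nonzero by simp
  moreover have "x = 0" using 0 calculation by (simp add: cmb_def)
  ultimately show "x = 0 \<and> y = 0 \<and> z = 0" by simp
qed (simp add: cmb_def)

lemma cmb_eq_iff: "cmb x y z = cmb x' y' z' \<longleftrightarrow> x = x' \<and> y = y' \<and> z = z'"
  using cmb_eq_0_iff[of "x - x'" "y - y'" "z - z'"] by (simp flip: cmb_diff)

lemma inverse_cmb: "\<exists>x' y' z'. inverse (cmb x y z) = cmb x' y' z'"
proof (cases "cmb x y z = 0")
  case True
  \<comment> \<open>The inverse of 0 is 0 by convention, so this case is needed and
    harmless.\<close>
  then have "inverse (cmb x y z) = cmb 0 0 0" by (simp add: cmb_def)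
  then show ?thesis by blast
next
  case False
  \<comment> \<open>the product of the other two conjugates\<close>
  define x' where "x' = x\<^sup>2 - of_int (h * k) * (y * z)"
  define y' where "y' = of_int h * z\<^sup>2 - x * y"
  define z' where "z' = of_int k * y\<^sup>2 - x * z"
  \<comment> \<open>The norm of \<open>cmb x y z\<close>: it is the rational coordinate of the
    product, and the other two coordinates cancel.\<close>
  define N where "N = x * x' + of_int (h * k) * (y * z' + y' * z)"
  have prod: "cmb x y z * cmb x' y' z' = of_rat N"
  proof -
    have "cmb x y z * cmb x' y' z' = cmb N 0 0"
      unfolding cmb_mult cmb_eq_iff N_def x'_def y'_def z'_def
      by (simp add: power2_eq_square algebra_simps)
    then show ?thesis by (simp add: cmb_def)
  qed
  have "cmb x' y' z' \<noteq> 0"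
  proof
    assume "cmb x' y' z' = 0"
    then have "x = 0 \<and> y = 0 \<and> z = 0"
      unfolding cmb_eq_0_iff x'_def y'_def z'_def by (intro cofactor_zero) auto
    with False show False by (simp add: cmb_eq_0_iff)
  qed
  with prod False have "N \<noteq> 0" by auto
  have "inverse (cmb x y z) = of_rat (1 / N) * cmb x' y' z'"
    using prod False \<open>N \<noteq> 0\<close> by (simp add: of_rat_divide field_simps)
  also have "\<dots> = cmb (1 / N * x') (1 / N * y') (1 / N * z')"
    by (rule cmb_scale)
  finally show ?thesis by blast
qed

text \<open>The rational span of the basis is closed under products and, by
  \<open>inverse_cmb\<close>, under inverses, so it is already the smallest subfield containing
  \<theta>.\<close>

lemma rat_adjoin_eq: "rat_adjoin \<theta> = {cmb x y z | x y z. True}" (is "_ = ?T")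
proof
  have "is_subfield ?T"
    unfolding is_subfield_def
  proof (intro conjI ballI)
    have "0 = cmb 0 0 0" "1 = cmb 1 0 0" by (simp_all add: cmb_def)
    then show "0 \<in> ?T" "1 \<in> ?T" by blast+
  next
    fix u v assume "u \<in> ?T" "v \<in> ?T"
    then obtain x y z x' y' z' where uv: "u = cmb x y z" "v = cmb x' y' z'" by blast
    show "u - v \<in> ?T" unfolding uv cmb_diff by blast
    show "u * v \<in> ?T" unfolding uv cmb_mult by blast
  next
    fix u assume "u \<in> ?T"
    then show "inverse u \<in> ?T" using inverse_cmb by auto
  qed
  moreover have "\<theta> = cmb 0 1 0" by (simp add: cmb_def)
  ultimately show "rat_adjoin \<theta> \<subseteq> ?T"
    unfolding rat_adjoin_def by blast
next
  show "?T \<subseteq> rat_adjoin \<theta>"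
    unfolding rat_adjoin_def
  proof (clarify)
    fix x y z F assume F: "is_subfield F" "\<theta> \<in> F"
    have "cmb x y z = of_rat x + of_rat y * \<theta> + of_rat z * (\<theta> * \<theta> * inverse (of_int k))"
      by (simp add: cmb_def power2_eq_square field_simps)
    moreover have "of_rat y * \<theta> \<in> F" "of_rat z * (\<theta> * \<theta> * inverse (of_int k)) \<in> F"
      using F subfield_of_rat subfield_of_int unfolding is_subfield_def by auto
    ultimately show "cmb x y z \<in> F"
      using F by (simp add: subfield_add subfield_of_rat)
  qed
qed

lemma span_basis: "rat_space.span {1, \<theta>, \<theta>\<^sup>2 / of_int k} = rat_adjoin \<theta>"
  unfolding rat_adjoin_eq
  by (auto simp: rat_space.span_insert cmb_def) (auto simp: algebra_simps)

section \<open>Which lattices are orders\<close>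

lemma lat_subset: "lat a b c \<subseteq> rat_adjoin \<theta>"
  unfolding rat_adjoin_eq lat_def by blast

lemma cmb_in_lat_iff:
  "cmb (of_int x) (of_int y) (of_int z) \<in> lat a b c \<longleftrightarrow> (\<exists>u v. y = a * u + b * v \<and> z = c * v)"
  unfolding lat_def by (auto simp: cmb_eq_iff simp del: of_int_mult of_int_add)

text \<open>Over the rationals, dividing by \<open>a\<close> and \<open>c\<close> recovers the
  basis. Hence the rank condition in \<open>is_order\<close> holds for every such lattice, and only
  closure under multiplication has to be tested.\<close>

lemma span_lat:
  assumes "a \<noteq> 0" "c \<noteq> 0"
  shows "rat_space.span (lat a b c) = rat_adjoin \<theta>"
proof
  show "rat_space.span (lat a b c) \<subseteq> rat_adjoin \<theta>"
    using lat_subset rat_space.subspace_span unfolding span_basis[symmetric]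
    by (intro rat_space.span_minimal)
next
  let ?S = "rat_space.span (lat a b c)"
  have i: "cmb (of_int x) (of_int (a * y + b * z)) (of_int (c * z)) \<in> ?S" for x y z
    by (rule rat_space.span_base) (auto simp: lat_def)
  have 1: "1 \<in> ?S" using i[of 1 0 0] by (simp add: cmb_def)
  have "of_int a * \<theta> \<in> ?S" using i[of 0 1 0] by (simp add: cmb_def)
  then have "of_rat (1 / of_int a) * (of_int a * \<theta>) \<in> ?S" by (rule rat_space.span_scale)
  then have t: "\<theta> \<in> ?S" using assms by (simp add: of_rat_divide)
  have "of_int b * \<theta> + of_int c * (\<theta>\<^sup>2 / of_int k) \<in> ?S" using i[of 0 0 1] by (simp add: cmb_def)
  moreover have "of_rat (of_int b) * \<theta> \<in> ?S" using t by (rule rat_space.span_scale)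
  ultimately have "of_int b * \<theta> + of_int c * (\<theta>\<^sup>2 / of_int k) - of_rat (of_int b) * \<theta> \<in> ?S"
    by (rule rat_space.span_diff)
  then have "of_int c * (\<theta>\<^sup>2 / of_int k) \<in> ?S" by simp
  then have "of_rat (1 / of_int c) * (of_int c * (\<theta>\<^sup>2 / of_int k)) \<in> ?S" by (rule rat_space.span_scale)
  then have "\<theta>\<^sup>2 / of_int k \<in> ?S" using assms by (simp add: of_rat_divide)
  with 1 t have "rat_space.span {1, \<theta>, \<theta>\<^sup>2 / of_int k} \<subseteq> ?S"
    by (intro rat_space.span_minimal) auto
  then show "rat_adjoin \<theta> \<subseteq> ?S" by (simp add: span_basis)
qed

text \<open>
  The conditions under which \<open>(a\<theta>)\<^sup>2\<close>, \<open>a\<theta>v\<close> and \<open>v\<^sup>2\<close> lie in \<open>lat a b c\<close>, where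
  \<open>v = b\<theta> + c\<theta>\<^sup>2/k\<close>; the other divisibilities that membership demands follow from these four.
\<close>

definition mult_closed :: "int \<Rightarrow> int \<Rightarrow> int \<Rightarrow> bool" where
  "mult_closed a b c \<longleftrightarrow>
     c dvd a\<^sup>2 * k \<and> c dvd a * b * k \<and> c dvd b\<^sup>2 * k \<and> a * c dvd c ^ 3 * h - b ^ 3 * k"

lemma cmb_of_int_mult:
  "cmb (of_int x) (of_int y) (of_int z) * cmb (of_int x') (of_int y') (of_int z') =
     cmb (of_int (x * x' + h * k * (y * z' + y' * z)))
         (of_int (x * y' + x' * y + h * (z * z')))
         (of_int (x * z' + x' * z + k * (y * y')))"
  by (simp add: cmb_mult)

text \<open>Closure is decided on the products of the generators a\<theta> and w = b\<theta> +
  c\<theta>^2/k. Membership of these also demands divisibilities by \<open>a\<close> of their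
  \<theta>-coordinates, recovered from \<open>mult_closed\<close> by cancelling
  \<open>c\<close>.\<close>

lemma is_subring_lat_iff:
  assumes "a \<noteq> 0" "c \<noteq> 0"
  shows "is_subring (lat a b c) \<longleftrightarrow> mult_closed a b c"
proof
  assume R: "is_subring (lat a b c)"
  let ?u = "cmb (of_int 0) (of_int a) (of_int 0)" and ?v = "cmb (of_int 0) (of_int b) (of_int c)"
  have "?u \<in> lat a b c" "?v \<in> lat a b c"
    unfolding cmb_in_lat_iff by (rule exI[of _ 1], rule exI[of _ 0], simp)
      (rule exI[of _ 0], rule exI[of _ 1], simp)
  then have "?u * ?u \<in> lat a b c" "?u * ?v \<in> lat a b c" "?v * ?v \<in> lat a b c"
    using R unfolding is_subring_def by blast+
  then have "\<exists>u v. 0 = a * u + b * v \<and> k * (a * a) = c * v"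
    "\<exists>u v. 0 = a * u + b * v \<and> k * (a * b) = c * v"
    "\<exists>u v. h * (c * c) = a * u + b * v \<and> k * (b * b) = c * v"
    unfolding cmb_of_int_mult cmb_in_lat_iff by simp_all
  then obtain v1 v2 u3 v3 where
    "k * (a * a) = c * v1" "k * (a * b) = c * v2" "h * (c * c) = a * u3 + b * v3" "k * (b * b) = c * v3"
    by blast
  note v = this
  have "c * (h * (c * c)) = a * c * u3 + b * (c * v3)"
    unfolding v(3) by (simp add: algebra_simps)
  then have "c ^ 3 * h - b ^ 3 * k = a * c * u3"
    unfolding v(4)[symmetric] by (simp add: power3_eq_cube algebra_simps)
  moreover have "a\<^sup>2 * k = c * v1" "a * b * k = c * v2" "b\<^sup>2 * k = c * v3"
    using v by (simp_all add: power2_eq_square mult_ac)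
  ultimately show "mult_closed a b c"
    unfolding mult_closed_def by (metis dvd_triv_left)
next
  assume "mult_closed a b c"
  then obtain s1 s2 s3 q where s: "a\<^sup>2 * k = c * s1" "a * b * k = c * s2" "b\<^sup>2 * k = c * s3"
    "c ^ 3 * h - b ^ 3 * k = a * c * q"
    unfolding mult_closed_def dvd_def by blast
  \<comment> \<open>Each quantity is written in two ways, once through the witnesses and once by
    regrouping factors; cancelling \<open>c\<close> then gives the relations
    \<open>r\<close>.\<close>
  have "c * (b * s1) = b * (a\<^sup>2 * k)" "c * (b * s2) = b * (a * b * k)"
    "c * (c\<^sup>2 * h - b * s3) = c ^ 3 * h - b * (b\<^sup>2 * k)"
    unfolding s by (simp_all add: power2_eq_square power3_eq_cube algebra_simps)
  moreover have "b * (a\<^sup>2 * k) = a * (a * b * k)" "b * (a * b * k) = a * (b\<^sup>2 * k)"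
    "c ^ 3 * h - b * (b\<^sup>2 * k) = a * c * q"
    using s(4) by (simp_all add: power2_eq_square power3_eq_cube mult_ac)
  ultimately have "c * (b * s1) = c * (a * s2)" "c * (b * s2) = c * (a * s3)"
    "c * (c\<^sup>2 * h - b * s3) = c * (a * q)"
    unfolding s by (simp_all add: mult_ac)
  with assms have r: "b * s1 = a * s2" "b * s2 = a * s3" "c\<^sup>2 * h - b * s3 = a * q"
    by simp_all
  show "is_subring (lat a b c)"
    unfolding is_subring_def
  proof (intro conjI ballI)
    have "1 = cmb (of_int 1) (of_int 0) (of_int 0)" by (simp add: cmb_def)
    also have "\<dots> \<in> lat a b c" unfolding cmb_in_lat_iff by (intro exI[of _ 0]) simp
    finally show "1 \<in> lat a b c" .
  next
    fix u v assume "u \<in> lat a b c" "v \<in> lat a b c"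
    then obtain x y z x' y' z' where
      u: "u = cmb (of_int x) (of_int (a * y + b * z)) (of_int (c * z))" and
      v: "v = cmb (of_int x') (of_int (a * y' + b * z')) (of_int (c * z'))"
      unfolding lat_def by blast
    have "u - v = cmb (of_int (x - x')) (of_int (a * (y - y') + b * (z - z'))) (of_int (c * (z - z')))"
      unfolding u v cmb_diff cmb_eq_iff by (simp add: algebra_simps)
    then show "u - v \<in> lat a b c" unfolding lat_def by blast
    show "u * v \<in> lat a b c"
      unfolding u v cmb_of_int_mult cmb_in_lat_iff
    proof (intro exI conjI)
      \<comment> \<open>Read off from the multiplication table (a\<theta>)^2 = s1 w - s2 a\<theta>,
        a\<theta> w = achk + s2 w - s3 a\<theta>, w^2 = 2bchk + q a\<theta> + s3 w, where w =
        b\<theta> + c\<theta>^2/k. Thus \<open>?y\<close> and \<open>?z\<close> are the coordinates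
        of the product on a\<theta> and w.\<close>
      let ?z = "x * z' + x' * z + s1 * y * y' + s2 * (y * z' + y' * z) + s3 * z * z'"
      let ?y = "x * y' + x' * y + q * z * z' - s2 * y * y' - s3 * (y * z' + y' * z)"
      have "a * ?y + b * ?z = x * (a * y' + b * z') + x' * (a * y + b * z)
          + (a * q + b * s3) * (z * z') + (b * s1 - a * s2) * (y * y') + (b * s2 - a * s3) * (y * z' + y' * z)"
        by (simp add: algebra_simps)
      also have "\<dots> = x * (a * y' + b * z') + x' * (a * y + b * z) + c\<^sup>2 * h * (z * z')"
        unfolding r(1,2) r(3)[symmetric] by simp
      finally show "x * (a * y' + b * z') + x' * (a * y + b * z) + h * (c * z * (c * z')) = a * ?y + b * ?z"
        by (simp add: power2_eq_square mult_ac)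
      have "k * ((a * y + b * z) * (a * y' + b * z')) =
          (a\<^sup>2 * k) * (y * y') + (a * b * k) * (y * z' + y' * z) + (b\<^sup>2 * k) * (z * z')"
        by (simp add: algebra_simps power2_eq_square)
      then show "x * (c * z') + x' * (c * z) + k * ((a * y + b * z) * (a * y' + b * z')) = c * ?z"
        unfolding s by (simp add: algebra_simps)
    qed
  qed
qed

lemma lat_eq_int_span:
  "lat a b c = int_span {1, of_int a * \<theta>, of_int b * \<theta> + of_int c * (\<theta>\<^sup>2 / of_int k)}"
proof -
  have "cmb (of_int x) (of_int (a * y + b * z)) (of_int (c * z)) =
      of_int x * 1 + of_int y * (of_int a * \<theta>) + of_int z * (of_int b * \<theta> + of_int c * (\<theta>\<^sup>2 / of_int k))"
    for x y z
    unfolding cmb_def of_rat_of_int_eq unfolding of_int_add of_int_mult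
    by (simp only: algebra_simps mult_1_left mult_1_right)
  then show ?thesis
    unfolding lat_def int_span_3 by simp
qed

lemma is_order_lat_iff:
  assumes "a \<noteq> 0" "c \<noteq> 0"
  shows "is_order (rat_adjoin \<theta>) (lat a b c) \<longleftrightarrow> mult_closed a b c"
proof -
  have "rat_dim (lat a b c) = rat_dim (rat_adjoin \<theta>)"
    by (metis span_lat[OF assms] rat_space.dim_span)
  moreover have "\<exists>S. finite S \<and> lat a b c = int_span S"
    by (rule exI, rule conjI[rotated], rule lat_eq_int_span) simp
  ultimately show ?thesis
    unfolding is_order_def using lat_subset is_subring_lat_iff[OF assms] by blast
qed

section \<open>From Hermite normal forms to triples (a, b, c)\<close>

lemma lattice_of_mat_lower_triangular:
  assumes A: "A \<in> carrier_mat 3 3" and z: "\<forall>i<3. \<forall>j<3. i < j \<longrightarrow> A $$ (i, j) = 0"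
  shows "lattice_of_mat [1, \<theta>, \<theta>\<^sup>2 / of_int k] A =
    {cmb (of_int (x * A $$ (0,0) + y * A $$ (1,0) + z * A $$ (2,0)))
         (of_int (y * A $$ (1,1) + z * A $$ (2,1))) (of_int (z * A $$ (2,2))) | x y z. True}"
proof -
  define v where "v = map_mat of_int A *\<^sub>v vec_of_list [1, \<theta>, \<theta>\<^sup>2 / of_int k]"
  have 3: "{..<3::nat} = {0, 1, 2}" "{0..<3::nat} = {0, 1, 2}" by auto
  have d: "dim_vec v = 3" using A by (simp add: v_def)
  have v: "v $ i = of_int (A $$ (i,0)) + of_int (A $$ (i,1)) * \<theta> + of_int (A $$ (i,2)) * (\<theta>\<^sup>2 / of_int k)"
    if "i < 3" for i
    using that A by (simp add: v_def scalar_prod_def 3 numeral_2_eq_2)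
  have "{v $ i | i. i < dim_vec v} = (\<lambda>i. v $ i) ` {0, 1, 2}"
    unfolding d 3(1)[symmetric] by auto
  also have "\<dots> = {of_int (A $$ (0,0)), of_int (A $$ (1,0)) + of_int (A $$ (1,1)) * \<theta>,
     of_int (A $$ (2,0)) + of_int (A $$ (2,1)) * \<theta> + of_int (A $$ (2,2)) * (\<theta>\<^sup>2 / of_int k)}"
    using v[of 0] v[of 1] v[of 2] z by simp
  finally have "lattice_of_mat [1, \<theta>, \<theta>\<^sup>2 / of_int k] A = int_span \<dots>"
    by (simp add: lattice_of_mat_def v_def)
  moreover have "cmb (of_int (x * A $$ (0,0) + y * A $$ (1,0) + z * A $$ (2,0)))
         (of_int (y * A $$ (1,1) + z * A $$ (2,1))) (of_int (z * A $$ (2,2))) =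
      of_int x * of_int (A $$ (0,0)) + of_int y * (of_int (A $$ (1,0)) + of_int (A $$ (1,1)) * \<theta>) +
      of_int z * (of_int (A $$ (2,0)) + of_int (A $$ (2,1)) * \<theta> + of_int (A $$ (2,2)) * (\<theta>\<^sup>2 / of_int k))"
    for x y z
    unfolding cmb_def of_rat_of_int_eq unfolding of_int_add of_int_mult by (simp only: algebra_simps)
  ultimately show ?thesis
    unfolding int_span_3 by simp
qed

lemma lattice_of_hnf_mat: "lattice_of_mat [1, \<theta>, \<theta>\<^sup>2 / of_int k] (hnf_mat a b c) = lat a b c"
  by (subst lattice_of_mat_lower_triangular) (auto simp: all_less_3 lat_def mult.commute)

lemma order_mats_eq:
  assumes "N > 0"
  shows "order_mats (rat_adjoin \<theta>) [1, \<theta>, \<theta>\<^sup>2 / of_int k] N =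
    (\<lambda>(a, b, c). hnf_mat a b c) `
      {(a, b, c). 0 < a \<and> 0 < c \<and> a * c = int N \<and> 0 \<le> b \<and> b < a \<and> mult_closed a b c}"
    (is "?L = ?R")
proof
  show "?L \<subseteq> ?R"
  proof
    fix A assume "A \<in> ?L"
    then have A: "A \<in> carrier_mat 3 3" and z: "\<forall>i<3. \<forall>j<3. i < j \<longrightarrow> A $$ (i, j) = 0"
      and d: "det A = int N" and nn: "\<forall>i<3. \<forall>j<3. 0 \<le> A $$ (i, j)"
      and lt: "\<forall>i<3. \<forall>j<3. j < i \<longrightarrow> A $$ (i, j) < A $$ (j, j)"
      and ord: "is_order (rat_adjoin \<theta>) (lattice_of_mat [1, \<theta>, \<theta>\<^sup>2 / of_int k] A)"
      by (auto simp: order_mats_def hnf_mats_def)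
    have N: "A $$ (0,0) * A $$ (1,1) * A $$ (2,2) = int N"
      using d det_lower_triangular_3[OF A z] by simp
    then have nz: "A $$ (1,1) \<noteq> 0" "A $$ (2,2) \<noteq> 0" using assms by auto
    have "1 \<in> lattice_of_mat [1, \<theta>, \<theta>\<^sup>2 / of_int k] A"
      using ord by (simp add: is_order_def is_subring_def)
    \<comment> \<open>Write 1 as an integer combination of the rows. The nonzero diagonal kills the
      coefficients of the last two rows, so the top left entry divides 1.\<close>
    then obtain x y u where "cmb (of_int 1) (of_int 0) (of_int 0) =
        cmb (of_int (x * A $$ (0,0) + y * A $$ (1,0) + u * A $$ (2,0)))
         (of_int (y * A $$ (1,1) + u * A $$ (2,1))) (of_int (u * A $$ (2,2)))"
      unfolding lattice_of_mat_lower_triangular[OF A z] by (auto simp: cmb_def)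
    then have eqs: "u * A $$ (2,2) = 0" "y * A $$ (1,1) + u * A $$ (2,1) = 0"
        "x * A $$ (0,0) + y * A $$ (1,0) + u * A $$ (2,0) = 1"
      unfolding cmb_eq_iff of_int_eq_iff by simp_all
    then have "u = 0" using nz by simp
    with eqs nz have "y = 0" by simp
    with eqs \<open>u = 0\<close> have "x * A $$ (0,0) = 1" by simp
    moreover have "A $$ (0,0) \<ge> 0" using nn by (simp add: all_less_3)
    ultimately have a0: "A $$ (0,0) = 1" by (auto simp: zmult_eq_1_iff)
    \<comment> \<open>Entries below the diagonal are nonnegative and smaller than the diagonal entry
      of their column, which is 1 here.\<close>
    have col: "A $$ (1,0) = 0" "A $$ (2,0) = 0"
      using nn lt a0 by (auto simp: all_less_3)
    define a b c where "a = A $$ (1,1)" "b = A $$ (2,1)" "c = A $$ (2,2)"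
    have Ah: "A = hnf_mat a b c"
      unfolding a_b_c_def by (rule eq_hnf_mat[OF A z a0 col])
    have "0 < a" "0 < c" "0 \<le> b" "b < a" "a * c = int N"
      using nn lt nz N a0 by (auto simp: all_less_3 a_b_c_def)
    moreover have "mult_closed a b c"
      using ord is_order_lat_iff[of a c b] calculation by (simp add: Ah lattice_of_hnf_mat)
    ultimately show "A \<in> ?R" unfolding Ah by (intro image_eqI[of _ _ "(a, b, c)"]) simp_all
  qed
  show "?R \<subseteq> ?L"
  proof
    fix A assume "A \<in> ?R"
    then obtain a b c where A: "A = hnf_mat a b c" and
      *: "0 < a" "0 < c" "a * c = int N" "0 \<le> b" "b < a" "mult_closed a b c"
      by auto
    have len: "length [1, \<theta>, \<theta>\<^sup>2 / of_int k] = 3" by simp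
    have "\<forall>i<3. \<forall>j<3. i < j \<longrightarrow> A $$ (i, j) = 0"
      by (simp add: all_less_3 A)
    moreover from this have "det A = int N"
      using * by (subst det_lower_triangular_3) (auto simp: A)
    moreover have "is_order (rat_adjoin \<theta>) (lattice_of_mat [1, \<theta>, \<theta>\<^sup>2 / of_int k] A)"
      using * by (simp add: A lattice_of_hnf_mat is_order_lat_iff)
    ultimately show "A \<in> ?L"
      using * unfolding order_mats_def hnf_mats_def len by (simp add: all_less_3 A)
  qed
qed

text \<open>A positive divisor \<open>a\<close> of p^n is some p^i, which fixes \<open>c\<close>.
  The matrix entries recover \<open>i\<close> and \<open>b\<close>, so the count splits over
  \<open>i\<close>.\<close>

lemma card_order_mats_prime_power:
  assumes p: "prime p"
  shows "card (order_mats (rat_adjoin \<theta>) [1, \<theta>, \<theta>\<^sup>2 / of_int k] (p ^ n)) =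
    (\<Sum>i\<le>n. card {b \<in> {0..<int p ^ i}. mult_closed (int p ^ i) b (int p ^ (n - i))})"
proof -
  let ?P = "int p"
  have p1: "?P > 1" using prime_gt_1_nat[OF p] by simp
  let ?S = "SIGMA i:{..n}. {b \<in> {0..<?P ^ i}. mult_closed (?P ^ i) b (?P ^ (n - i))}"
  let ?f = "\<lambda>(i, b). hnf_mat (?P ^ i) b (?P ^ (n - i))"
  have "{(a, b, c). 0 < a \<and> 0 < c \<and> a * c = int (p ^ n) \<and> 0 \<le> b \<and> b < a \<and> mult_closed a b c} =
      (\<lambda>(i, b). (?P ^ i, b, ?P ^ (n - i))) ` ?S" (is "?L = ?R")
  proof
    show "?L \<subseteq> ?R"
    proof clarify
      fix a b c :: int
      assume *: "0 < a" "0 < c" "a * c = int (p ^ n)" "0 \<le> b" "b < a" "mult_closed a b c"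
      have "a dvd ?P ^ n" using *(3) by (metis dvd_triv_left of_nat_power)
      then obtain i where i: "i \<le> n" "a = ?P ^ i"
        using p * by (auto elim!: divides_primepow[rotated])
      have "?P ^ i * c = ?P ^ i * ?P ^ (n - i)"
        using *(3) i by (simp flip: power_add)
      then have "c = ?P ^ (n - i)" using p1 by simp
      then show "(a, b, c) \<in> ?R" using * i by (intro image_eqI[of _ _ "(i, b)"]) auto
    qed
    show "?R \<subseteq> ?L" using p1 by (auto simp flip: power_add)
  qed
  then have "order_mats (rat_adjoin \<theta>) [1, \<theta>, \<theta>\<^sup>2 / of_int k] (p ^ n) = ?f ` ?S"
    using p by (subst order_mats_eq) (auto simp: image_image case_prod_unfold prime_gt_0_nat)
  moreover have "inj_on ?f ?S"
  proof (rule inj_onI, clarify)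
    fix i b j d assume eq: "hnf_mat (?P ^ i) b (?P ^ (n - i)) = hnf_mat (?P ^ j) d (?P ^ (n - j))"
    have "?P ^ i = ?P ^ j" using arg_cong[OF eq, of "\<lambda>A. A $$ (Suc 0, Suc 0)"] by simp
    moreover have "b = d" using arg_cong[OF eq, of "\<lambda>A. A $$ (2, Suc 0)"] by simp
    ultimately show "i = j \<and> b = d" using p1 by simp
  qed
  moreover have "finite {b \<in> {0..<?P ^ i}. mult_closed (?P ^ i) b (?P ^ (n - i))}" for i
    by (rule finite_subset[of _ "{0..<?P ^ i}"]) auto
  then have "card ?S = (\<Sum>i\<le>n. card {b \<in> {0..<?P ^ i}. mult_closed (?P ^ i) b (?P ^ (n - i))})"
    by (subst card_SigmaI) blast+
  ultimately show ?thesis by (simp only: card_image)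
qed

section \<open>Counting the orders\<close>

text \<open>Let \<open>j = n - i\<close>; \<open>t\<close> is n/3 rounded up. If both
  \<open>i\<close> and \<open>j\<close> are at least \<open>t\<close>, then p^n divides c^3 h and
  the conditions become p^t | b. If \<open>j < t\<close>, then p^j is forced into \<open>b\<close>
  and a Hensel count remains. If \<open>i < t\<close>, there is no solution.\<close>

lemma card_mult_closed_coprime:
  assumes p: "prime p" "p \<noteq> 3" and hk: "\<not> int p dvd h" "\<not> int p dvd k"
    and i: "i \<le> n" and t: "n \<le> 3 * t" "3 * t < n + 3"
  shows "card {b \<in> {0..<int p ^ i}. mult_closed (int p ^ i) b (int p ^ (n - i))} =
    (if t \<le> i \<and> i + t \<le> n then p ^ (i - t)
     else if n < i + t then p ^ (n - i) * num_cube_roots_mod p (h * k\<^sup>2) else 0)"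
proof -
  let ?P = "int p"
  define j where "j = n - i"
  have n: "n = i + j" using i by (simp add: j_def)
  have P: "prime ?P" using p by simp
  have pos: "?P > 0" using prime_gt_0_nat[OF p(1)] by simp
  note pd = prime_power_dvd_prime_power_iff[OF P] and km = prime_power_dvd_mult_iff[OF P hk(2)]
  have mc: "mult_closed (?P ^ i) b (?P ^ j) \<longleftrightarrow> j \<le> 2 * i \<and> ?P ^ j dvd ?P ^ i * b \<and> ?P ^ j dvd b\<^sup>2
      \<and> ?P ^ n dvd ?P ^ (3 * j) * h - b ^ 3 * k" for b
    unfolding mult_closed_def km
    by (simp add: n pd power_add mult.commute flip: power_mult)
  consider "i < t" | "t \<le> i" "t \<le> j" | "j < t" "t \<le> i" by linarith
  then show ?thesis
  proof cases
    case 1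
    \<comment> \<open>The condition \<open>j \<le> 2 * i\<close> amounts to
      \<open>n \<le> 3 * i\<close>, hence to \<open>t \<le> i\<close>.\<close>
    then have "{b \<in> {0..<?P ^ i}. mult_closed (?P ^ i) b (?P ^ j)} = {}"
      using t n by (auto simp: mc)
    then have "card {b \<in> {0..<?P ^ i}. mult_closed (?P ^ i) b (?P ^ j)} = 0" by (simp only: card.empty)
    then show ?thesis using 1 t n unfolding j_def[symmetric] by simp
  next
    case 2
    have "mult_closed (?P ^ i) b (?P ^ j) \<longleftrightarrow> ?P ^ t dvd b" for b
    proof -
      have "?P ^ n dvd ?P ^ (3 * j) * h" using 2 t by (intro dvd_mult2) (simp add: pd)
      then have "?P ^ n dvd ?P ^ (3 * j) * h - b ^ 3 * k \<longleftrightarrow> ?P ^ n dvd b ^ 3"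
        by (simp add: dvd_diff_right_iff km)
      also have "\<dots> \<longleftrightarrow> ?P ^ t dvd b" by (rule prime_power_dvd_cube_iff[OF P t])
      finally have *: "?P ^ n dvd ?P ^ (3 * j) * h - b ^ 3 * k \<longleftrightarrow> ?P ^ t dvd b" .
      have "?P ^ j dvd ?P ^ i * b \<and> ?P ^ j dvd b\<^sup>2" if b: "?P ^ t dvd b"
      proof
        have "?P ^ j dvd ?P ^ i * ?P ^ t" using 2 t n by (simp add: pd flip: power_add)
        also have "\<dots> dvd ?P ^ i * b" using b by simp
        finally show "?P ^ j dvd ?P ^ i * b" .
        have "?P ^ j dvd (?P ^ t)\<^sup>2" using 2 t n by (simp add: pd flip: power_mult)
        also have "\<dots> dvd b\<^sup>2" using b by (rule dvd_power_same)
        finally show "?P ^ j dvd b\<^sup>2" .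
      qed
      then show ?thesis using mc * 2 t n by auto
    qed
    then show ?thesis
      using 2 n card_prime_power_multiples[OF p(1) \<open>t \<le> i\<close>] unfolding j_def[symmetric] by simp
  next
    case 3
    have j: "3 * j < n" using 3 t by simp
    let ?Q = "\<lambda>b. ?P ^ (i - 2 * j) dvd h - b ^ 3 * k"
    have "mult_closed (?P ^ i) b (?P ^ j) \<longleftrightarrow> ?P ^ j dvd b \<and> ?Q (b div ?P ^ j)" for b
    proof -
      have *: "?P ^ n dvd ?P ^ (3 * j) * h - b ^ 3 * k \<longleftrightarrow> ?Q b'" if "b = ?P ^ j * b'" for b'
      proof -
        have "?P ^ (3 * j) * h - b ^ 3 * k = ?P ^ (3 * j) * (h - b' ^ 3 * k)"
          by (simp add: that power_mult_distrib algebra_simps flip: power_mult)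
        moreover have "n - 3 * j = i - 2 * j" using n by simp
        ultimately show ?thesis using j by (simp add: prime_power_dvd_power_mult_iff[OF P])
      qed
      have "?P ^ j dvd b" if "?P ^ n dvd ?P ^ (3 * j) * h - b ^ 3 * k"
      proof -
        have "?P ^ (3 * j) dvd ?P ^ n" using j by (simp add: pd)
        then have "?P ^ (3 * j) dvd ?P ^ (3 * j) * h - b ^ 3 * k" using that dvd_trans by blast
        then have "?P ^ (3 * j) dvd b ^ 3" by (simp add: dvd_diff_right_iff km)
        then show ?thesis by (subst (asm) prime_power_dvd_cube_iff[OF P, of _ j]) simp_all
      qed
      moreover have "?P ^ j dvd ?P ^ i * b \<and> ?P ^ j dvd b\<^sup>2" if "?P ^ j dvd b"
        using that by (simp add: power2_eq_square)
      moreover have "j \<le> 2 * i" using j n by simp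
      moreover have "b = ?P ^ j * (b div ?P ^ j)" if "?P ^ j dvd b" using that by simp
      ultimately show ?thesis using mc * by blast
    qed
    then have "card {b \<in> {0..<?P ^ i}. mult_closed (?P ^ i) b (?P ^ j)} =
        card {b \<in> {0..<?P ^ j * ?P ^ (i - j)}. ?P ^ j dvd b \<and> ?Q (b div ?P ^ j)}"
      using j n by (simp flip: power_add)
    also have "\<dots> = card {b \<in> {0..<?P ^ (i - j)}. ?Q b}"
      using pos by (intro card_multiples) auto
    \<comment> \<open>The quotient of \<open>b\<close> by p^j runs through p^j full periods of
      length p^(i - 2j). The exponent \<open>i - 2 * j\<close> equals \<open>n - 3 * j\<close>,
      which is positive, so each period contains as many solutions as there are cube roots of h k^2
      modulo \<open>p\<close>.\<close>
    also have "?P ^ (i - j) = ?P ^ (i - 2 * j) * int (p ^ j)"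
      using j n by (simp flip: power_add)
    also have "card {b \<in> {0..<?P ^ (i - 2 * j) * int (p ^ j)}. ?Q b} =
        p ^ j * card {b \<in> {0..<?P ^ (i - 2 * j)}. ?Q b}"
    proof (rule card_periodic)
      fix x
      have "[h - (x mod ?P ^ (i - 2 * j)) ^ 3 * k = h - x ^ 3 * k] (mod ?P ^ (i - 2 * j))"
        by (intro cong_diff cong_mult cong_pow cong_refl) (simp add: cong_def)
      then show "?Q (x mod ?P ^ (i - 2 * j)) \<longleftrightarrow> ?Q x" by (rule cong_dvd_iff)
    qed (use pos in simp)
    also have "card {b \<in> {0..<?P ^ (i - 2 * j)}. ?Q b} = num_cube_roots_mod p (h * k\<^sup>2)"
      using j n by (intro card_cube_roots_prime_power p hk) simp
    finally show ?thesis using 3 n unfolding j_def[symmetric] by simp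
  qed
qed

text \<open>The multiplicity of \<open>p\<close> in c^3 h is 3j + 1 with \<open>j = n - i\<close>,
  while in b^3 k it is a multiple of 3 (or \<open>b\<close> is 0), so the two terms cannot cancel.
  Hence p^n must divide both: this means \<open>n \<le> 3 * j + 1\<close>, that is
  \<open>3 * i \<le> 2 * n + 1\<close>, and p^t | b.\<close>

lemma card_mult_closed_dvd_h:
  assumes p: "prime p" and h: "int p dvd h" "\<not> (int p)\<^sup>2 dvd h" and k: "\<not> int p dvd k"
    and i: "i \<le> n" and t: "n \<le> 3 * t" "3 * t < n + 3"
  shows "card {b \<in> {0..<int p ^ i}. mult_closed (int p ^ i) b (int p ^ (n - i))} =
    (if t \<le> i \<and> 3 * i \<le> 2 * n + 1 then p ^ (i - t) else 0)"
proof -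
  let ?P = "int p"
  define j where "j = n - i"
  have n: "n = i + j" using i by (simp add: j_def)
  have P: "prime ?P" using p by simp
  obtain g where g: "h = ?P * g" using h(1) by blast
  have ng: "\<not> ?P dvd g" using h(2) by (auto simp: g power2_eq_square)
  note pd = prime_power_dvd_prime_power_iff[OF P] and km = prime_power_dvd_mult_iff[OF P k]
    and gm = prime_power_dvd_mult_iff[OF P ng]
  have hg: "?P ^ (3 * j) * h = ?P ^ (3 * j + 1) * g" by (simp add: g)
  have mc: "mult_closed (?P ^ i) b (?P ^ j) \<longleftrightarrow> j \<le> 2 * i \<and> ?P ^ j dvd ?P ^ i * b \<and> ?P ^ j dvd b\<^sup>2
      \<and> ?P ^ n dvd ?P ^ (3 * j + 1) * g - b ^ 3 * k" for b
    unfolding mult_closed_def km hg[symmetric]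
    by (simp add: n pd power_add mult.commute flip: power_mult)
  show ?thesis
  proof (cases "t \<le> i \<and> n \<le> 3 * j + 1")
    case True
    have "mult_closed (?P ^ i) b (?P ^ j) \<longleftrightarrow> ?P ^ t dvd b" for b
    proof -
      have "?P ^ n dvd ?P ^ (3 * j + 1) * g" using True by (intro dvd_mult2) (simp only: pd)
      then have "?P ^ n dvd ?P ^ (3 * j + 1) * g - b ^ 3 * k \<longleftrightarrow> ?P ^ n dvd b ^ 3"
        by (simp only: dvd_diff_right_iff km)
      also have "\<dots> \<longleftrightarrow> ?P ^ t dvd b" by (rule prime_power_dvd_cube_iff[OF P t])
      finally have *: "?P ^ n dvd ?P ^ (3 * j + 1) * g - b ^ 3 * k \<longleftrightarrow> ?P ^ t dvd b" .
      have "?P ^ j dvd ?P ^ i * b \<and> ?P ^ j dvd b\<^sup>2" if b: "?P ^ t dvd b"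
      proof
        have "?P ^ j dvd ?P ^ i * ?P ^ t" using True t n by (simp add: pd flip: power_add)
        also have "\<dots> dvd ?P ^ i * b" using b by simp
        finally show "?P ^ j dvd ?P ^ i * b" .
        have "?P ^ j dvd (?P ^ t)\<^sup>2" using True t n by (simp add: pd flip: power_mult)
        also have "\<dots> dvd b\<^sup>2" using b by (rule dvd_power_same)
        finally show "?P ^ j dvd b\<^sup>2" .
      qed
      then show ?thesis using mc * True t n by auto
    qed
    then show ?thesis
      using True n card_prime_power_multiples[OF p, of t i] unfolding j_def[symmetric] by simp
  next
    case False
    have "\<not> mult_closed (?P ^ i) b (?P ^ j)" for b
    proof
      assume b: "mult_closed (?P ^ i) b (?P ^ j)"
      then have "j \<le> 2 * i" by (simp add: mc)
      then have "t \<le> i" using t n by simp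
      with False have j: "3 * j + 2 \<le> n" by simp
      have d: "?P ^ a dvd ?P ^ (3 * j + 1) * g - b ^ 3 * k" if "a \<le> n" for a
        using b that dvd_trans[of "?P ^ a" "?P ^ n"] unfolding mc pd by blast
      \<comment> \<open>A cube divisible by p^(3j + 1) is divisible by p^(3j + 3), so p^(3j + 2)
        would have to divide c^3 h.\<close>
      have "?P ^ (3 * j + 1) dvd b ^ 3"
        using d[of "3 * j + 1"] j by (simp add: dvd_diff_right_iff km del: power_Suc)
      then have "?P ^ (j + 1) dvd b"
        by (subst (asm) prime_power_dvd_cube_iff[OF P, of _ "j + 1"]) simp_all
      then have "?P ^ (3 * j + 2) dvd b ^ 3"
        by (subst prime_power_dvd_cube_iff[OF P, of _ "j + 1"]) simp_all
      then have "?P ^ (3 * j + 2) dvd (?P ^ (3 * j + 1) * g - b ^ 3 * k) + b ^ 3 * k"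
        using j by (intro dvd_add d dvd_mult2) auto
      then have "?P ^ (3 * j + 2) dvd ?P ^ (3 * j + 1)"
        by (simp only: diff_add_cancel gm)
      then show False unfolding pd by simp
    qed
    then have "{b \<in> {0..<?P ^ i}. mult_closed (?P ^ i) b (?P ^ j)} = {}" by blast
    then have "card {b \<in> {0..<?P ^ i}. mult_closed (?P ^ i) b (?P ^ j)} = 0" by (simp only: card.empty)
    then show ?thesis using False n unfolding j_def[symmetric] by auto
  qed
qed

text \<open>The roles are exchanged: c^3 h has multiplicity 3j and b^3 k has multiplicity 1 modulo 3
  unless \<open>b\<close> is 0. Again p^n must divide both terms, now with bound
  \<open>3 * i \<le> 2 * n\<close> and \<open>t\<close> equal to (n - 1)/3 rounded up.\<close>

lemma card_mult_closed_dvd_k: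
  assumes p: "prime p" and h: "\<not> int p dvd h" and k: "int p dvd k" "\<not> (int p)\<^sup>2 dvd k"
    and i: "i \<le> n" and t: "n \<le> 3 * t + 1" "3 * t < n + 2"
  shows "card {b \<in> {0..<int p ^ i}. mult_closed (int p ^ i) b (int p ^ (n - i))} =
    (if t \<le> i \<and> 3 * i \<le> 2 * n then p ^ (i - t) else 0)"
proof -
  let ?P = "int p"
  define j where "j = n - i"
  have n: "n = i + j" using i by (simp add: j_def)
  have P: "prime ?P" using p by simp
  obtain g where g: "k = ?P * g" using k(1) by blast
  have ng: "\<not> ?P dvd g" using k(2) by (auto simp: g power2_eq_square)
  note pd = prime_power_dvd_prime_power_iff[OF P] and hm = prime_power_dvd_mult_iff[OF P h]
    and gm = prime_power_dvd_mult_iff[OF P ng]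
  have kg: "x * k = ?P * x * g" for x by (simp add: g)
  have i2: "?P * (?P ^ i)\<^sup>2 = ?P ^ (2 * i + 1)" by (simp add: mult.commute flip: power_mult)
  have mc: "mult_closed (?P ^ i) b (?P ^ j) \<longleftrightarrow> j \<le> 2 * i + 1 \<and> ?P ^ j dvd ?P * (?P ^ i * b)
      \<and> ?P ^ j dvd ?P * b\<^sup>2 \<and> ?P ^ n dvd ?P ^ (3 * j) * h - ?P * b ^ 3 * g" for b
    unfolding mult_closed_def kg gm i2 pd n
    by (simp add: power_add mult.commute flip: power_mult)
  show ?thesis
  proof (cases "t \<le> i \<and> n \<le> 3 * j")
    case True
    have "mult_closed (?P ^ i) b (?P ^ j) \<longleftrightarrow> ?P ^ t dvd b" for b
    proof -
      have "?P ^ n dvd ?P ^ (3 * j) * h" using True by (intro dvd_mult2) (simp only: pd)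
      then have "?P ^ n dvd ?P ^ (3 * j) * h - ?P * b ^ 3 * g \<longleftrightarrow> ?P ^ n dvd ?P * b ^ 3"
        by (simp only: dvd_diff_right_iff gm)
      also have "\<dots> \<longleftrightarrow> ?P ^ t dvd b" by (rule prime_power_dvd_prime_mult_cube_iff[OF P t])
      finally have *: "?P ^ n dvd ?P ^ (3 * j) * h - ?P * b ^ 3 * g \<longleftrightarrow> ?P ^ t dvd b" .
      have "?P ^ j dvd ?P * (?P ^ i * b) \<and> ?P ^ j dvd ?P * b\<^sup>2" if b: "?P ^ t dvd b"
      proof
        have "j \<le> i + t + 1" using True t n by linarith
        then have "?P ^ j dvd ?P ^ (i + t + 1)" by (simp only: pd)
        also have "\<dots> = ?P * (?P ^ i * ?P ^ t)" by (simp add: power_add)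
        also have "\<dots> dvd ?P * (?P ^ i * b)" using b by simp
        finally show "?P ^ j dvd ?P * (?P ^ i * b)" .
        have "j \<le> t * 2 + 1" using True t n by linarith
        then have "?P ^ j dvd ?P ^ (t * 2 + 1)" by (simp only: pd)
        also have "\<dots> = ?P * (?P ^ t)\<^sup>2" by (simp flip: power_mult)
        also have "\<dots> dvd ?P * b\<^sup>2" using b by (intro mult_dvd_mono dvd_power_same) auto
        finally show "?P ^ j dvd ?P * b\<^sup>2" .
      qed
      then show ?thesis using mc * True t n by auto
    qed
    then show ?thesis
      using True n card_prime_power_multiples[OF p, of t i] unfolding j_def[symmetric] by simp
  next
    case False
    have "\<not> mult_closed (?P ^ i) b (?P ^ j)" for b
    proof
      assume b: "mult_closed (?P ^ i) b (?P ^ j)"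
      then have "j \<le> 2 * i + 1" by (simp add: mc)
      then have "t \<le> i" using t n by simp
      with False have j: "3 * j + 1 \<le> n" by simp
      have d: "?P ^ a dvd ?P ^ (3 * j) * h - ?P * b ^ 3 * g" if "a \<le> n" for a
        using b that dvd_trans[of "?P ^ a" "?P ^ n"] unfolding mc pd by blast
      \<comment> \<open>Divisibility of p b^3 by p^(3j) already gives p^j | b, and with it the
        further factor that c^3 h lacks.\<close>
      have "?P ^ (3 * j) dvd ?P * b ^ 3"
        using d[of "3 * j"] j by (simp add: dvd_diff_right_iff gm)
      then have "?P ^ j dvd b"
        by (subst (asm) prime_power_dvd_prime_mult_cube_iff[OF P, of _ j]) simp_all
      then have "?P ^ (3 * j + 1) dvd ?P * b ^ 3"
        by (subst prime_power_dvd_prime_mult_cube_iff[OF P, of _ j]) simp_all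
      then have "?P ^ (3 * j + 1) dvd (?P ^ (3 * j) * h - ?P * b ^ 3 * g) + ?P * b ^ 3 * g"
        using j by (intro dvd_add[OF d dvd_mult2]) auto
      then have "?P ^ (3 * j + 1) dvd ?P ^ (3 * j)"
        by (simp only: diff_add_cancel hm)
      then show False unfolding pd by simp
    qed
    then have "{b \<in> {0..<?P ^ i}. mult_closed (?P ^ i) b (?P ^ j)} = {}" by blast
    then have "card {b \<in> {0..<?P ^ i}. mult_closed (?P ^ i) b (?P ^ j)} = 0" by (simp only: card.empty)
    then show ?thesis using False n unfolding j_def[symmetric] by auto
  qed
qed

text \<open>Squarefreeness and coprimality place \<open>p\<close> in exactly one of \<open>h\<close>
  and \<open>k\<close>, and there only once. Both cases yield a full run of n div 3 + 1 powers of
  \<open>p\<close>.\<close>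

lemma card_order_mats_dvd:
  assumes p: "prime p" and sq: "squarefree h" "squarefree k" "coprime h k"
    and m: "int p dvd h * k\<^sup>2"
  shows "card (order_mats (rat_adjoin \<theta>) [1, \<theta>, \<theta>\<^sup>2 / of_int k] (p ^ n)) = (\<Sum>s<n div 3 + 1. p ^ s)"
proof -
  have P: "prime (int p)" using p by simp
  have nsq: "\<not> (int p)\<^sup>2 dvd x" if "squarefree x" for x
    using that P not_prime_unit unfolding squarefree_def by blast
  have "int p dvd h \<or> int p dvd k"
    using m P prime_dvd_mult_iff prime_dvd_power by blast
  moreover have "\<not> (int p dvd h \<and> int p dvd k)"
    using sq(3) P not_prime_unit coprime_common_divisor by blast
  ultimately consider "int p dvd h" "\<not> int p dvd k" | "\<not> int p dvd h" "int p dvd k" by blast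
  then show ?thesis
  proof cases
    case 1
    \<comment> \<open>The least and greatest \<open>i\<close> with a nonzero count: n/3 rounded up
      and (2n + 1)/3 rounded down.\<close>
    define t where "t = (n + 2) div 3"
    define u where "u = (2 * n + 1) div 3"
    have "card (order_mats (rat_adjoin \<theta>) [1, \<theta>, \<theta>\<^sup>2 / of_int k] (p ^ n)) =
        (\<Sum>i\<le>n. if t \<le> i \<and> i \<le> u then p ^ (i - t) else 0)"
      unfolding card_order_mats_prime_power[OF p]
    proof (rule sum.cong)
      fix i assume "i \<in> {..n}"
      then have "i \<le> n" by simp
      moreover have "n \<le> 3 * t" "3 * t < n + 3" unfolding t_def by linarith+
      moreover have "3 * i \<le> 2 * n + 1 \<longleftrightarrow> i \<le> u" unfolding u_def by linarith
      ultimately show "card {b \<in> {0..<int p ^ i}. mult_closed (int p ^ i) b (int p ^ (n - i))} =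
          (if t \<le> i \<and> i \<le> u then p ^ (i - t) else 0)"
        using card_mult_closed_dvd_h[OF p 1(1) nsq[OF sq(1)] 1(2)] by simp
    qed simp
    also have "\<dots> = (\<Sum>s<Suc u - t. p ^ s)"
      unfolding t_def u_def by (rule sum_powers_shift) linarith+
    also have "Suc u - t = n div 3 + 1" unfolding t_def u_def by (rule div_3_differences(1))
    finally show ?thesis .
  next
    case 2
    \<comment> \<open>With \<open>p\<close> dividing \<open>k\<close> the range of \<open>i\<close>
      runs from (n - 1)/3 rounded up to 2n/3 rounded down.\<close>
    define t where "t = (n + 1) div 3"
    define u where "u = 2 * n div 3"
    have "card (order_mats (rat_adjoin \<theta>) [1, \<theta>, \<theta>\<^sup>2 / of_int k] (p ^ n)) =
        (\<Sum>i\<le>n. if t \<le> i \<and> i \<le> u then p ^ (i - t) else 0)"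
      unfolding card_order_mats_prime_power[OF p]
    proof (rule sum.cong)
      fix i assume "i \<in> {..n}"
      then have "i \<le> n" by simp
      moreover have "n \<le> 3 * t + 1" "3 * t < n + 2" unfolding t_def by linarith+
      moreover have "3 * i \<le> 2 * n \<longleftrightarrow> i \<le> u" unfolding u_def by linarith
      ultimately show "card {b \<in> {0..<int p ^ i}. mult_closed (int p ^ i) b (int p ^ (n - i))} =
          (if t \<le> i \<and> i \<le> u then p ^ (i - t) else 0)"
        using card_mult_closed_dvd_k[OF p 2 nsq[OF sq(2)]] by simp
    qed simp
    also have "\<dots> = (\<Sum>s<Suc u - t. p ^ s)"
      unfolding t_def u_def by (rule sum_powers_shift) linarith+
    also have "Suc u - t = n div 3 + 1" unfolding t_def u_def by (rule div_3_differences(2))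
    finally show ?thesis .
  qed
qed

text \<open>The middle range of \<open>i\<close> gives the first geometric sum. The top range
  \<open>n - i < t\<close>, reversed by \<open>i \<mapsto> n - i\<close>, gives the sum weighted by
  the number of cube roots.\<close>

lemma card_order_mats_not_dvd:
  fixes n :: nat
  defines "t \<equiv> (n + 2) div 3"
  assumes p: "prime p" "p \<noteq> 3" and m: "\<not> int p dvd h * k\<^sup>2"
  shows "card (order_mats (rat_adjoin \<theta>) [1, \<theta>, \<theta>\<^sup>2 / of_int k] (p ^ n)) =
    (\<Sum>s<n + 1 - 2 * t. p ^ s) + (\<Sum>s<t. p ^ s) * num_cube_roots_mod p (h * k\<^sup>2)"
proof -
  let ?r = "num_cube_roots_mod p (h * k\<^sup>2)"
  have hk: "\<not> int p dvd h" "\<not> int p dvd k"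
    using m by (auto simp: power2_eq_square)
  have t: "n \<le> 3 * t" "3 * t < n + 3" unfolding t_def by linarith+
  have "card (order_mats (rat_adjoin \<theta>) [1, \<theta>, \<theta>\<^sup>2 / of_int k] (p ^ n)) =
      (\<Sum>i\<le>n. (if t \<le> i \<and> i \<le> n - t then p ^ (i - t) else 0) + (if n - i < t then p ^ (n - i) * ?r else 0))"
    unfolding card_order_mats_prime_power[OF p(1)]
  proof (rule sum.cong)
    fix i assume "i \<in> {..n}"
    then have i: "i \<le> n" by simp
    then have "i + t \<le> n \<longleftrightarrow> i \<le> n - t \<and> t \<le> n" "n < i + t \<longleftrightarrow> n - i < t" by linarith+
    then show "card {b \<in> {0..<int p ^ i}. mult_closed (int p ^ i) b (int p ^ (n - i))} =
        (if t \<le> i \<and> i \<le> n - t then p ^ (i - t) else 0) + (if n - i < t then p ^ (n - i) * ?r else 0)"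
      unfolding card_mult_closed_coprime[OF p hk i t] using i t by auto
  qed simp
  also have "\<dots> = (\<Sum>i\<le>n. if t \<le> i \<and> i \<le> n - t then p ^ (i - t) else 0)
      + (\<Sum>i\<le>n. if n - i < t then p ^ (n - i) * ?r else 0)"
    by (rule sum.distrib)
  also have "(\<Sum>i\<le>n. if t \<le> i \<and> i \<le> n - t then p ^ (i - t) else 0) = (\<Sum>s<Suc (n - t) - t. p ^ s)"
    using t by (intro sum_powers_shift) linarith+
  also have "Suc (n - t) - t = n + 1 - 2 * t" using t by linarith
  also have "(\<Sum>i\<le>n. if n - i < t then p ^ (n - i) * ?r else 0) = (\<Sum>i\<le>n. if i < t then p ^ i * ?r else 0)"
    by (rule sum.reindex_bij_witness[of _ "\<lambda>i. n - i" "\<lambda>i. n - i"]) auto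
  also have "\<dots> = (\<Sum>i<t. p ^ i * ?r)"
    using t by (intro sum.mono_neutral_cong_right) auto
  also have "\<dots> = (\<Sum>s<t. p ^ s) * ?r" by (rule sum_distrib_right[symmetric])
  finally show ?thesis .
qed

end

theorem theorem2p5:
  fixes m h k :: int and \<theta> :: complex and K :: "complex set" and p n :: nat
  assumes "cube_free m"
    and "\<not> [m\<^sup>2 = 1] (mod 9)"
    and "m = h * k\<^sup>2"
    and "squarefree h" and "squarefree k" and "coprime h k"
    and "\<theta> = complex_of_real (root 3 (real_of_int m))"
    and "K = rat_adjoin \<theta>"
    and "prime p" and "p \<noteq> 2" and "p \<noteq> 3"
  shows "real (card (order_mats K [1, \<theta>, \<theta>\<^sup>2 / of_int k] (p ^ n))) =
    (if int p dvd m
     then (real p powi (\<lfloor>real n / 3\<rfloor> + 1) - 1) / (real p - 1)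
     else (real p powi (\<lfloor>2 * real n / 3\<rfloor> - \<lceil>real n / 3\<rceil> + 1) - 1) / (real p - 1)
          + (real p powi \<lceil>real n / 3\<rceil> - 1) / (real p - 1) * real (num_cube_roots_mod p m))"
proof -
  \<comment> \<open>The real cube root is odd, so negative \<open>m\<close> is covered as
    well.\<close>
  have "root 3 (real_of_int m) ^ 3 = real_of_int m"
    by (simp add: odd_real_root_pow)
  then have "\<theta> ^ 3 = of_int m"
    unfolding assms(7) by (metis of_real_power of_real_of_int_eq)
  then interpret pure_cubic h k \<theta>
    using cube_free_not_rat_cube[OF assms(1,2)] unfolding assms(3) by unfold_locales
  define t where "t = (n + 2) div 3"
  have p1: "p > 1" using assms(9) by (rule prime_gt_1_nat)
  have "\<lfloor>real n / real 3\<rfloor> = int (n div 3)" "\<lfloor>real (2 * n) / real 3\<rfloor> = int (2 * n div 3)"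
    by (rule floor_divide_of_nat_eq)+
  then have fl: "\<lfloor>real n / 3\<rfloor> + 1 = int (n div 3 + 1)" "\<lfloor>2 * real n / 3\<rfloor> = int (2 * n div 3)"
    by simp_all
  have "n \<le> 3 * t" "3 * t < n + 3" unfolding t_def by linarith+
  then have ce: "\<lceil>real n / 3\<rceil> = int t" by (simp add: ceiling_eq_iff)
  \<comment> \<open>Here 2n/3 rounded down plus n/3 rounded up is \<open>n\<close>. The second
    inequality makes the integer exponent nonnegative, so truncated subtraction computes it
    correctly, including the value 0 at \<open>n = 1\<close>.\<close>
  have "2 * n div 3 + 1 - t = n + 1 - 2 * t" "t \<le> 2 * n div 3 + 1" unfolding t_def by linarith+
  then have ex: "\<lfloor>2 * real n / 3\<rfloor> - \<lceil>real n / 3\<rceil> + 1 = int (n + 1 - 2 * t)"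
    unfolding fl ce by linarith
  show ?thesis
  proof (cases "int p dvd m")
    case True
    then show ?thesis
      using card_order_mats_dvd[OF assms(9,4-6), of n] assms(3)
      unfolding assms(8) fl(1) power_int_of_nat sum_powers_real[OF p1, symmetric] by simp
  next
    case False
    then show ?thesis
      using card_order_mats_not_dvd[OF assms(9,11), of n] assms(3)
      unfolding assms(8) ex unfolding ce power_int_of_nat sum_powers_real[OF p1, symmetric] t_def[symmetric]
      by simp
  qed
qed

end
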